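(* Let $\mathbf{u}_h^k,\mathbf{B}_h^k\in H_0^h(\mathrm{div})$, $k\ge0$, be produced by the fully discrete scheme described in the context (with time step $\Delta t>0$), with $\nabla\cdot\mathbf{u}_h^0=0$ and $\nabla\cdot\mathbf{B}_h^0=0$. Then the scheme preserves the energy and magnetic helicity exactly and enforces $\nabla\cdot\mathbf{B}_h=\nabla\cdot\mathbf{u}_h=0$ for all time steps: for all $k\ge0$, $$\int_\Omega\mathbf{u}_h^{k+1}\cdot\mathbf{u}_h^{k+1}+S\,\mathbf{B}_h^{k+1}\cdot\mathbf{B}_h^{k+1}\,\mathrm{d}x=\int_\Omega\mathbf{u}_h^k\cdot\mathbf{u}_h^k+S\,\mathbf{B}_h^k\cdot\mathbf{B}_h^k\,\mathrm{d}x,$$ $$\int_\Omega\mathbf{A}_h^{k+1}\cdot\mathbf{B}_h^{k+1}\,\mathrm{d}x=\int_\Omega\mathbf{A}_h^k\cdot\mathbf{B}_h^k\,\mathrm{d}x,$$ $$\nabla\cdot\mathbf{u}_h^k=0,\qquad\nabla\cdot\mathbf{B}_h^k=0.$$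
   Context: $\Omega\subset\mathbb{R}^3$ is a bounded, contractible Lipschitz polyhedron; $(\cdot,\cdot)$ is the $L^2(\Omega)$ inner product; $L_0^2(\Omega)$ is the space of mean-zero $L^2$ functions; $S>0$, $\mathrm{R_H}\ge0$ are constants. $H_0^h(\mathrm{grad})\subset H_0^1(\Omega)$, $H_0^h(\mathrm{curl})\subset H_0(\mathrm{curl},\Omega)$ (vanishing tangential trace), $H_0^h(\mathrm{div})\subset H_0(\mathrm{div},\Omega)$ (vanishing normal trace), $L_h^2$ are conforming finite element spaces forming a finite element de Rham sequence $$0\to H_0^h(\mathrm{grad})\xrightarrow{\mathrm{grad}}H_0^h(\mathrm{curl})\xrightarrow{\mathrm{curl}}H_0^h(\mathrm{div})\xrightarrow{\mathrm{div}}L_h^2\to0,$$ exact since $\Omega$ is contractible. $\mathbf{A}_h^k\in H_0^h(\mathrm{curl})$ denotes a discrete vector potential, $\nabla\times\mathbf{A}_h^k=\mathbf{B}_h^k$. Scheme (ideal case $\mathbf{f}=\mathbf{0}$, formally $\mathrm{Re}^{-1}=\mathrm{Re_m}^{-1}=0$): given $\mathbf{u}_h^k,\mathbf{B}_h^k$, write $D_t\mathbf{u}_h=(\mathbf{u}_h^{k+1}-\mathbf{u}_h^k)/\Delta t$, $D_t\mathbf{B}_h=(\mathbf{B}_h^{k+1}-\mathbf{B}_h^k)/\Delta t$, $\mathbf{u}_h^{k+1/2}=\frac12(\mathbf{u}_h^{k+1}+\mathbf{u}_h^k)$, $\mathbf{B}_h^{k+1/2}=\frac12(\mathbf{B}_h^{k+1}+\mathbf{B}_h^k)$.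 Find $\mathbf{u}_h^{k+1},\mathbf{B}_h^{k+1}\in H_0^h(\mathrm{div})$ and midpoint auxiliary variables (not averages; all at level $k+\frac12$, superscript suppressed) $p_h\in L_0^2(\Omega)$ and $\mathbf{E}_h,\mathbf{j}_h,\mathbf{H}_h,\boldsymbol{\omega}_h,\mathbf{U}_h,\boldsymbol{\alpha}_h\in H_0^h(\mathrm{curl})$ such that for all $\mathbf{v}_h,\mathbf{C}_h\in H_0^h(\mathrm{div})$, $q_h\in L_0^2(\Omega)$, $\mathbf{F}_h,\mathbf{G}_h,\boldsymbol{\mu}_h,\mathbf{V}_h,\boldsymbol{\beta}_h,\mathbf{k}_h\in H_0^h(\mathrm{curl})$: $$(D_t\mathbf{u}_h,\mathbf{v}_h)+(\boldsymbol{\alpha}_h,\mathbf{v}_h)+(\nabla\cdot\mathbf{v}_h,p_h)=0,\qquad(\nabla\cdot\mathbf{u}_h^{k+1/2},q_h)=0,$$ $$(D_t\mathbf{B}_h,\mathbf{C}_h)+(\nabla\times\mathbf{E}_h,\mathbf{C}_h)=0,\qquad(\mathbf{j}_h,\mathbf{F}_h)-(\mathbf{B}_h^{k+1/2},\nabla\times\mathbf{F}_h)=0,$$ $$(\mathbf{H}_h,\mathbf{G}_h)-(\mathbf{B}_h^{k+1/2},\mathbf{G}_h)=0,\qquad(\boldsymbol{\omega}_h,\boldsymbol{\mu}_h)-(\mathbf{u}_h^{k+1/2},\nabla\times\boldsymbol{\mu}_h)=0,$$ $$(\mathbf{U}_h,\mathbf{V}_h)-(\mathbf{u}_h^{k+1/2},\mathbf{V}_h)=0,$$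 $$(\boldsymbol{\alpha}_h,\boldsymbol{\beta}_h)-(\boldsymbol{\omega}_h\times\mathbf{U}_h,\boldsymbol{\beta}_h)+S(\mathbf{j}_h\times\mathbf{H}_h,\boldsymbol{\beta}_h)=0,$$ $$(\mathbf{E}_h,\mathbf{k}_h)-((\mathrm{R_H}\,\mathbf{j}_h-\mathbf{U}_h)\times\mathbf{H}_h,\mathbf{k}_h)=0.$$ *)

theory Defs
  imports "HOL-Analysis.Analysis"
begin

type_synonym scalar_field = "real^3 \<Rightarrow> real"
type_synonym vector_field = "real^3 \<Rightarrow> real^3"

subsection \<open>The domain\<close>

text \<open>
  Locally, after a rigid motion, the domain is the part of a ball that lies strictly
  below the graph of a Lipschitz function of the first two coordinates.
\<close>
definition lipschitz_boundary :: "(real^3) set \<Rightarrow> bool" where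
  "lipschitz_boundary \<Omega> \<longleftrightarrow>
     (\<forall>x \<in> frontier \<Omega>. \<exists>r > 0. \<exists>Q :: real^3 \<Rightarrow> real^3. \<exists>g :: real^2 \<Rightarrow> real. \<exists>L.
        orthogonal_transformation Q \<and> L-lipschitz_on UNIV g \<and>
        (\<forall>y \<in> ball x r. y \<in> \<Omega> \<longleftrightarrow> Q y $ 3 < g (vector [Q y $ 1, Q y $ 2])))"

definition lipschitz_polyhedron :: "(real^3) set \<Rightarrow> bool" where
  "lipschitz_polyhedron \<Omega> \<longleftrightarrow>
     open \<Omega> \<and> connected \<Omega> \<and> \<Omega> \<noteq> {} \<and> lipschitz_boundary \<Omega> \<and>
     (\<exists>\<P>. finite \<P> \<and> (\<forall>P \<in> \<P>. polytope P) \<and> closure \<Omega> = \<Union>\<P>)"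

subsection \<open>Lebesgue spaces\<close>

text \<open>
  Elements of the spaces below are functions on the whole space. Only their values on the
  domain matter, and two functions that agree almost everywhere on the domain represent
  the same element.
\<close>
definition L2 :: "(real^3) set \<Rightarrow> (real^3 \<Rightarrow> 'a::euclidean_space) set" where
  "L2 \<Omega> = {f \<in> borel_measurable (lebesgue_on \<Omega>). integrable (lebesgue_on \<Omega>) (\<lambda>x. (norm (f x))\<^sup>2)}"

definition L2_inner ::
    "(real^3) set \<Rightarrow> (real^3 \<Rightarrow> 'a::euclidean_space) \<Rightarrow> (real^3 \<Rightarrow> 'a) \<Rightarrow> real" where
  "L2_inner \<Omega> f g = (\<integral>x. f x \<bullet> g x \<partial>lebesgue_on \<Omega>)"

definition L2_mean_zero :: "(real^3) set \<Rightarrow> scalar_field set" where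
  "L2_mean_zero \<Omega> = {q \<in> L2 \<Omega>. (\<integral>x. q x \<partial>lebesgue_on \<Omega>) = 0}"

subsection \<open>Classical derivatives and test functions\<close>

definition partial :: "3 \<Rightarrow> scalar_field \<Rightarrow> scalar_field" where
  "partial i f x = frechet_derivative f (at x) (axis i 1)"

primrec Ck :: "nat \<Rightarrow> scalar_field \<Rightarrow> bool" where
  "Ck 0 f \<longleftrightarrow> continuous_on UNIV f"
| "Ck (Suc n) f \<longleftrightarrow> f differentiable_on UNIV \<and> (\<forall>i. Ck n (partial i f))"

definition test_function :: "(real^3) set \<Rightarrow> scalar_field \<Rightarrow> bool" where
  "test_function \<Omega> \<phi> \<longleftrightarrow>
     (\<forall>n. Ck n \<phi>) \<and> compact (closure {x. \<phi> x \<noteq> 0}) \<and> closure {x. \<phi> x \<noteq> 0} \<subseteq> \<Omega>"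

definition test_field :: "(real^3) set \<Rightarrow> vector_field \<Rightarrow> bool" where
  "test_field \<Omega> \<phi> \<longleftrightarrow> (\<forall>i. test_function \<Omega> (\<lambda>x. \<phi> x $ i))"

definition grad :: "scalar_field \<Rightarrow> vector_field" where
  "grad f x = (\<chi> i. partial i f x)"

definition curl :: "vector_field \<Rightarrow> vector_field" where
  "curl v x = vector
     [partial 2 (\<lambda>y. v y $ 3) x - partial 3 (\<lambda>y. v y $ 2) x,
      partial 3 (\<lambda>y. v y $ 1) x - partial 1 (\<lambda>y. v y $ 3) x,
      partial 1 (\<lambda>y. v y $ 2) x - partial 2 (\<lambda>y. v y $ 1) x]"

definition divergence :: "vector_field \<Rightarrow> scalar_field" where
  "divergence v x = (\<Sum>i\<in>UNIV. partial i (\<lambda>y. v y $ i) x)"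

subsection \<open>Weak derivatives\<close>

definition has_weak_grad :: "(real^3) set \<Rightarrow> scalar_field \<Rightarrow> vector_field \<Rightarrow> bool" where
  "has_weak_grad \<Omega> f g \<longleftrightarrow> f \<in> L2 \<Omega> \<and> g \<in> L2 \<Omega> \<and>
     (\<forall>\<phi>. test_field \<Omega> \<phi> \<longrightarrow> L2_inner \<Omega> g \<phi> = - L2_inner \<Omega> f (divergence \<phi>))"

definition has_weak_curl :: "(real^3) set \<Rightarrow> vector_field \<Rightarrow> vector_field \<Rightarrow> bool" where
  "has_weak_curl \<Omega> v w \<longleftrightarrow> v \<in> L2 \<Omega> \<and> w \<in> L2 \<Omega> \<and>
     (\<forall>\<phi>. test_field \<Omega> \<phi> \<longrightarrow> L2_inner \<Omega> w \<phi> = L2_inner \<Omega> v (curl \<phi>))"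

definition has_weak_div :: "(real^3) set \<Rightarrow> vector_field \<Rightarrow> scalar_field \<Rightarrow> bool" where
  "has_weak_div \<Omega> v d \<longleftrightarrow> v \<in> L2 \<Omega> \<and> d \<in> L2 \<Omega> \<and>
     (\<forall>\<phi>. test_function \<Omega> \<phi> \<longrightarrow> L2_inner \<Omega> d \<phi> = - L2_inner \<Omega> v (grad \<phi>))"

text \<open>Weak derivatives are unique almost everywhere; the operators pick a representative.\<close>
definition weak_curl :: "(real^3) set \<Rightarrow> vector_field \<Rightarrow> vector_field" where
  "weak_curl \<Omega> v = (SOME w. has_weak_curl \<Omega> v w)"

definition weak_div :: "(real^3) set \<Rightarrow> vector_field \<Rightarrow> scalar_field" where
  "weak_div \<Omega> v = (SOME d. has_weak_div \<Omega> v d)"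

subsection \<open>Sobolev spaces with boundary conditions\<close>

definition H1 :: "(real^3) set \<Rightarrow> scalar_field set" where
  "H1 \<Omega> = {f. \<exists>g. has_weak_grad \<Omega> f g}"

definition H1_field :: "(real^3) set \<Rightarrow> vector_field set" where
  "H1_field \<Omega> = {v. \<forall>i. (\<lambda>x. v x $ i) \<in> H1 \<Omega>}"

definition H_curl :: "(real^3) set \<Rightarrow> vector_field set" where
  "H_curl \<Omega> = {v. \<exists>w. has_weak_curl \<Omega> v w}"

definition H_div :: "(real^3) set \<Rightarrow> vector_field set" where
  "H_div \<Omega> = {v. \<exists>d. has_weak_div \<Omega> v d}"

text \<open>The closure of the test functions in the norm of \<open>H1\<close>.\<close>
definition H1_0 :: "(real^3) set \<Rightarrow> scalar_field set" where
  "H1_0 \<Omega> = {f. \<exists>g \<phi>. has_weak_grad \<Omega> f g \<and> (\<forall>n :: nat. test_function \<Omega> (\<phi> n)) \<and>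
     (\<lambda>n. \<integral>x. (f x - \<phi> n x)\<^sup>2 + (norm (g x - grad (\<phi> n) x))\<^sup>2 \<partial>lebesgue_on \<Omega>) \<longlonglongrightarrow> 0}"

text \<open>
  The tangential trace of a field \<open>v\<close> in \<open>H_curl\<close> and the normal trace of a field \<open>v\<close> in
  \<open>H_div\<close> are the functionals on \<open>H1\<close> (on its boundary values) given by Green's formula,
  \<open>\<phi> \<mapsto> (curl v, \<phi>) - (v, curl \<phi>)\<close> and \<open>q \<mapsto> (div v, q) + (v, grad q)\<close>.
\<close>
definition zero_tangential_trace :: "(real^3) set \<Rightarrow> vector_field \<Rightarrow> bool" where
  "zero_tangential_trace \<Omega> v \<longleftrightarrow>
     (\<forall>w \<phi> c. has_weak_curl \<Omega> v w \<and> \<phi> \<in> H1_field \<Omega> \<and> has_weak_curl \<Omega> \<phi> c \<longrightarrow>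
        L2_inner \<Omega> w \<phi> - L2_inner \<Omega> v c = 0)"

definition zero_normal_trace :: "(real^3) set \<Rightarrow> vector_field \<Rightarrow> bool" where
  "zero_normal_trace \<Omega> v \<longleftrightarrow>
     (\<forall>d q g. has_weak_div \<Omega> v d \<and> has_weak_grad \<Omega> q g \<longrightarrow>
        L2_inner \<Omega> d q + L2_inner \<Omega> v g = 0)"

definition H_curl_0 :: "(real^3) set \<Rightarrow> vector_field set" where
  "H_curl_0 \<Omega> = {v \<in> H_curl \<Omega>. zero_tangential_trace \<Omega> v}"

definition H_div_0 :: "(real^3) set \<Rightarrow> vector_field set" where
  "H_div_0 \<Omega> = {v \<in> H_div \<Omega>. zero_normal_trace \<Omega> v}"

subsection \<open>Finite element spaces\<close>

definition mesh :: "(real^3) set \<Rightarrow> (real^3) set set \<Rightarrow> bool" where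
  "mesh \<Omega> \<T> \<longleftrightarrow> finite \<T> \<and> (\<forall>K \<in> \<T>. polytope K \<and> interior K \<noteq> {}) \<and>
     pairwise (\<lambda>K K'. interior K \<inter> interior K' = {}) \<T> \<and> \<Union>\<T> = closure \<Omega>"

text \<open>
  A finite-dimensional space (modulo equality almost everywhere, under which it is
  saturated) of functions that on each cell are given by a shape function continuous up to
  the boundary of the cell. The shape functions are not required to be polynomials, so that
  no family of elements is singled out; cellwise continuity makes the functions bounded, so
  all trilinear terms of the scheme are integrable.
\<close>
definition finite_element_space ::
    "(real^3) set \<Rightarrow> (real^3) set set \<Rightarrow> (real^3 \<Rightarrow> 'a::euclidean_space) set \<Rightarrow> bool" where
  "finite_element_space \<Omega> \<T> V \<longleftrightarrow>
     V \<subseteq> L2 \<Omega> \<and>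
     (\<lambda>x. 0) \<in> V \<and>
     (\<forall>f \<in> V. \<forall>g \<in> V. (\<lambda>x. f x + g x) \<in> V) \<and>
     (\<forall>c. \<forall>f \<in> V. (\<lambda>x. c *\<^sub>R f x) \<in> V) \<and>
     (\<forall>f \<in> V. \<forall>g \<in> L2 \<Omega>. (AE x in lebesgue_on \<Omega>. f x = g x) \<longrightarrow> g \<in> V) \<and>
     (\<exists>(n::nat) b. \<forall>f \<in> V. \<exists>c. AE x in lebesgue_on \<Omega>. f x = (\<Sum>i<n. c i *\<^sub>R b i x)) \<and>
     (\<forall>f \<in> V. \<forall>K \<in> \<T>. \<exists>s. continuous_on K s \<and> (AE x in lebesgue_on (interior K). f x = s x))"

text \<open>
  The last four equations say that the sequence
  \<open>0 \<rightarrow> Vg \<rightarrow> Vc \<rightarrow> Vd \<rightarrow> Vl \<rightarrow> 0\<close> with maps grad, curl, div is an exact complex.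
\<close>
definition de_Rham_sequence ::
    "(real^3) set \<Rightarrow> (real^3) set set \<Rightarrow> scalar_field set \<Rightarrow> vector_field set \<Rightarrow>
     vector_field set \<Rightarrow> scalar_field set \<Rightarrow> bool" where
  "de_Rham_sequence \<Omega> \<T> Vg Vc Vd Vl \<longleftrightarrow>
     mesh \<Omega> \<T> \<and>
     finite_element_space \<Omega> \<T> Vg \<and> Vg \<subseteq> H1_0 \<Omega> \<and>
     finite_element_space \<Omega> \<T> Vc \<and> Vc \<subseteq> H_curl_0 \<Omega> \<and>
     finite_element_space \<Omega> \<T> Vd \<and> Vd \<subseteq> H_div_0 \<Omega> \<and>
     finite_element_space \<Omega> \<T> Vl \<and>
     {f \<in> Vg. has_weak_grad \<Omega> f (\<lambda>x. 0)} = {f \<in> L2 \<Omega>. AE x in lebesgue_on \<Omega>. f x = 0} \<and>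
     {g. \<exists>f \<in> Vg. has_weak_grad \<Omega> f g} = {v \<in> Vc. has_weak_curl \<Omega> v (\<lambda>x. 0)} \<and>
     {w. \<exists>v \<in> Vc. has_weak_curl \<Omega> v w} = {w \<in> Vd. has_weak_div \<Omega> w (\<lambda>x. 0)} \<and>
     {d. \<exists>w \<in> Vd. has_weak_div \<Omega> w d} = Vl"

subsection \<open>The scheme\<close>

definition time_average :: "vector_field \<Rightarrow> vector_field \<Rightarrow> vector_field" where
  "time_average v0 v1 x = (1/2) *\<^sub>R (v1 x + v0 x)"

definition difference_quotient :: "real \<Rightarrow> vector_field \<Rightarrow> vector_field \<Rightarrow> vector_field" where
  "difference_quotient dt v0 v1 x = (1/dt) *\<^sub>R (v1 x - v0 x)"

text \<open>
  One time step from \<open>(u0, B0)\<close> to \<open>(u1, B1)\<close>. The auxiliary midpoint variables are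
  \<open>p\<close>, \<open>E\<close>, \<open>j\<close>, \<open>H\<close>, \<open>\<omega>\<close>, \<open>U\<close>, \<open>\<alpha>\<close>.
\<close>
definition scheme_step ::
    "(real^3) set \<Rightarrow> vector_field set \<Rightarrow> vector_field set \<Rightarrow> real \<Rightarrow> real \<Rightarrow> real \<Rightarrow>
     vector_field \<Rightarrow> vector_field \<Rightarrow> vector_field \<Rightarrow> vector_field \<Rightarrow>
     scalar_field \<Rightarrow> vector_field \<Rightarrow> vector_field \<Rightarrow> vector_field \<Rightarrow>
     vector_field \<Rightarrow> vector_field \<Rightarrow> vector_field \<Rightarrow> bool" where
  "scheme_step \<Omega> Vc Vd S R\<^sub>H dt u0 B0 u1 B1 p E j H \<omega> U \<alpha> \<longleftrightarrow>
     u1 \<in> Vd \<and> B1 \<in> Vd \<and> p \<in> L2_mean_zero \<Omega> \<and>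
     E \<in> Vc \<and> j \<in> Vc \<and> H \<in> Vc \<and> \<omega> \<in> Vc \<and> U \<in> Vc \<and> \<alpha> \<in> Vc \<and>
     (\<forall>v \<in> Vd. L2_inner \<Omega> (difference_quotient dt u0 u1) v + L2_inner \<Omega> \<alpha> v
               + L2_inner \<Omega> (weak_div \<Omega> v) p = 0) \<and>
     (\<forall>q \<in> L2_mean_zero \<Omega>. L2_inner \<Omega> (weak_div \<Omega> (time_average u0 u1)) q = 0) \<and>
     (\<forall>C \<in> Vd. L2_inner \<Omega> (difference_quotient dt B0 B1) C + L2_inner \<Omega> (weak_curl \<Omega> E) C = 0) \<and>
     (\<forall>F \<in> Vc. L2_inner \<Omega> j F - L2_inner \<Omega> (time_average B0 B1) (weak_curl \<Omega> F) = 0) \<and>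
     (\<forall>G \<in> Vc. L2_inner \<Omega> H G - L2_inner \<Omega> (time_average B0 B1) G = 0) \<and>
     (\<forall>\<mu> \<in> Vc. L2_inner \<Omega> \<omega> \<mu> - L2_inner \<Omega> (time_average u0 u1) (weak_curl \<Omega> \<mu>) = 0) \<and>
     (\<forall>V \<in> Vc. L2_inner \<Omega> U V - L2_inner \<Omega> (time_average u0 u1) V = 0) \<and>
     (\<forall>\<beta> \<in> Vc. L2_inner \<Omega> \<alpha> \<beta> - L2_inner \<Omega> (\<lambda>x. cross3 (\<omega> x) (U x)) \<beta>
               + S * L2_inner \<Omega> (\<lambda>x. cross3 (j x) (H x)) \<beta> = 0) \<and>
     (\<forall>k \<in> Vc. L2_inner \<Omega> E k
               - L2_inner \<Omega> (\<lambda>x. cross3 (R\<^sub>H *\<^sub>R j x - U x) (H x)) k = 0)"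

end

theory Submission
  imports Defs
begin

text \<open>
  Energy conservation follows by testing with the midpoint fields. For the magnetic helicity,
  \<open>(A1, B1) - (A0, B0) = (A1 - A0, B1 + B0)\<close> once \<open>(A1, curl A0) = (curl A1, A0)\<close>, and
  \<open>A1 - A0 + dt E\<close> is curl free, so that only \<open>(E, B1 + B0) = 2 (E, H) = 0\<close> remains. Both uses of
  Green's formula involve two fields in \<open>H_curl\<close> with zero tangential trace, whereas the trace
  is defined by testing with fields in \<open>H1\<close> only. The gap is closed by mollification: as the
  zero trace removes the boundary term, mollifying over the domain commutes with the curl up to
  the boundary. Finite element fields are bounded and piecewise continuous, hence their
  mollifications converge almost everywhere.
\<close>

subsection \<open>Square integrable fields\<close>

text \<open>The obstacle is that fields in \<open>H_curl\<close> have no pointwise boundary values,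
  while the mollification of one field has to be an admissible \<open>H1\<close> test field for the
  other even next to the boundary. The zero trace helps because it implies that the extension by
  zero has the extended curl as its weak curl, and this extension is what gets mollified. Since the
  trace is tested with \<open>H1\<close> fields, a kernel that is merely C^1 suffices, so a
  piecewise polynomial one with explicit gradient is used.

  The constraints rest on two choices of test function. Curls of \<open>Vc\<close> lie in
  \<open>Vd\<close>, so Faraday's law can be tested with its own residual and holds almost
  everywhere. The divergence of the midpoint velocity has mean zero by the normal trace, so it may
  itself serve as pressure test function. Vanishing divergence then passes from level to level, and
  exactness supplies the potentials.\<close>

lemma L2_measurable: "f \<in> L2 \<Omega> \<Longrightarrow> f \<in> borel_measurable (lebesgue_on \<Omega>)"
  and L2_integrable: "f \<in> L2 \<Omega> \<Longrightarrow> integrable (lebesgue_on \<Omega>) (\<lambda>x. (norm (f x))\<^sup>2)"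
  by (auto simp: L2_def)

lemma L2_integrable_inner:
  assumes "f \<in> L2 \<Omega>" "g \<in> L2 \<Omega>"
  shows "integrable (lebesgue_on \<Omega>) (\<lambda>x. f x \<bullet> g x)"
proof (rule Bochner_Integration.integrable_bound)
  show "integrable (lebesgue_on \<Omega>) (\<lambda>x. (norm (f x))\<^sup>2 + (norm (g x))\<^sup>2)"
    using assms by (intro Bochner_Integration.integrable_add L2_integrable)
  show "(\<lambda>x. f x \<bullet> g x) \<in> borel_measurable (lebesgue_on \<Omega>)"
    using assms by (intro borel_measurable_inner L2_measurable)
  have "\<bar>f x \<bullet> g x\<bar> \<le> (norm (f x))\<^sup>2 + (norm (g x))\<^sup>2" for x
    using Cauchy_Schwarz_ineq2[of "f x" "g x"] sum_squares_bound[of "norm (f x)" "norm (g x)"]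
      zero_le_power2[of "norm (f x)"] zero_le_power2[of "norm (g x)"]
    by linarith
  then show "AE x in lebesgue_on \<Omega>. norm (f x \<bullet> g x) \<le> norm ((norm (f x))\<^sup>2 + (norm (g x))\<^sup>2)"
    by (intro AE_I2) (auto intro: order_trans)
qed

lemma L2_scaleR [intro]:
  assumes "f \<in> L2 \<Omega>" shows "(\<lambda>x. c *\<^sub>R f x) \<in> L2 \<Omega>"
  using assms by (auto simp: L2_def power_mult_distrib)

lemma L2_add [intro]:
  assumes "f \<in> L2 \<Omega>" "g \<in> L2 \<Omega>"
  shows "(\<lambda>x. f x + g x) \<in> L2 \<Omega>"
proof -
  have "integrable (lebesgue_on \<Omega>) (\<lambda>x. (norm (f x))\<^sup>2 + 2 * (f x \<bullet> g x) + (norm (g x))\<^sup>2)"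
    using assms
    by (intro Bochner_Integration.integrable_add integrable_mult_right L2_integrable
        L2_integrable_inner)
  also have "(\<lambda>x. (norm (f x))\<^sup>2 + 2 * (f x \<bullet> g x) + (norm (g x))\<^sup>2) = (\<lambda>x. (norm (f x + g x))\<^sup>2)"
    by (simp add: power2_norm_eq_inner inner_simps inner_commute algebra_simps fun_eq_iff)
  finally show ?thesis
    using assms by (auto simp: L2_def)
qed

lemma L2_diff [intro]:
  assumes "f \<in> L2 \<Omega>" "g \<in> L2 \<Omega>"
  shows "(\<lambda>x. f x - g x) \<in> L2 \<Omega>"
  using L2_add[OF assms(1) L2_scaleR[OF assms(2), of "-1"]] by simp

lemma L2_zero [intro, simp]: "(\<lambda>x. 0) \<in> L2 \<Omega>"
  by (simp add: L2_def)

lemma L2_inner_commute: "L2_inner \<Omega> f g = L2_inner \<Omega> g f"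
  by (simp add: L2_inner_def inner_commute)

lemma L2_inner_add_left:
  "\<lbrakk>f \<in> L2 \<Omega>; g \<in> L2 \<Omega>; h \<in> L2 \<Omega>\<rbrakk> \<Longrightarrow>
    L2_inner \<Omega> (\<lambda>x. f x + g x) h = L2_inner \<Omega> f h + L2_inner \<Omega> g h"
  by (simp add: L2_inner_def inner_add_left L2_integrable_inner)

lemma L2_inner_diff_left:
  "\<lbrakk>f \<in> L2 \<Omega>; g \<in> L2 \<Omega>; h \<in> L2 \<Omega>\<rbrakk> \<Longrightarrow>
    L2_inner \<Omega> (\<lambda>x. f x - g x) h = L2_inner \<Omega> f h - L2_inner \<Omega> g h"
  by (simp add: L2_inner_def inner_diff_left L2_integrable_inner)

lemma L2_inner_add_right:
  "\<lbrakk>f \<in> L2 \<Omega>; g \<in> L2 \<Omega>; h \<in> L2 \<Omega>\<rbrakk> \<Longrightarrow>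
    L2_inner \<Omega> h (\<lambda>x. f x + g x) = L2_inner \<Omega> h f + L2_inner \<Omega> h g"
  by (simp add: L2_inner_def inner_add_right L2_integrable_inner)

lemma L2_inner_scaleR_left: "L2_inner \<Omega> (\<lambda>x. c *\<^sub>R f x) h = c * L2_inner \<Omega> f h"
  by (simp add: L2_inner_def)

lemma L2_inner_scaleR_right: "L2_inner \<Omega> h (\<lambda>x. c *\<^sub>R f x) = c * L2_inner \<Omega> h f"
  by (simp add: L2_inner_def)

lemma L2_inner_zero [simp]: "L2_inner \<Omega> (\<lambda>x. 0) h = 0" "L2_inner \<Omega> h (\<lambda>x. 0) = 0"
  by (simp_all add: L2_inner_def)

lemma L2_inner_cong_AE:
  assumes "f \<in> L2 \<Omega>" "g \<in> L2 \<Omega>" "h \<in> L2 \<Omega>" "AE x in lebesgue_on \<Omega>. f x = g x"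
  shows "L2_inner \<Omega> f h = L2_inner \<Omega> g h"
  unfolding L2_inner_def using assms
  by (intro integral_cong_AE borel_measurable_inner L2_measurable) auto

text \<open>Turns a variational equation tested with its own residual into an identity almost
  everywhere; applied to the divergence of the midpoint velocity and to Faraday's law.\<close>

lemma L2_inner_self_eq_0:
  assumes "f \<in> L2 \<Omega>" "L2_inner \<Omega> f f = 0"
  shows "AE x in lebesgue_on \<Omega>. f x = 0"
proof -
  have "AE x in lebesgue_on \<Omega>. f x \<bullet> f x = 0"
    using assms integral_nonneg_eq_0_iff_AE[OF L2_integrable_inner[OF assms(1,1)]]
    by (simp add: L2_inner_def)
  then show ?thesis by simp
qed

lemma has_weak_div_L2: "has_weak_div \<Omega> v d \<Longrightarrow> v \<in> L2 \<Omega>" "has_weak_div \<Omega> v d \<Longrightarrow> d \<in> L2 \<Omega>"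
  and has_weak_curl_L2: "has_weak_curl \<Omega> v w \<Longrightarrow> v \<in> L2 \<Omega>" "has_weak_curl \<Omega> v w \<Longrightarrow> w \<in> L2 \<Omega>"
  by (auto simp: has_weak_div_def has_weak_curl_def)

subsection \<open>Classical derivatives and integration by parts\<close>

declare Ck.simps [simp del]

lemma Ck_Suc_has_derivative:
  assumes "Ck (Suc n) f"
  shows "(f has_derivative (\<lambda>h. grad f x \<bullet> h)) (at x)"
proof -
  have D: "(f has_derivative frechet_derivative f (at x)) (at x)"
    using assms frechet_derivative_works[of f "at x"]
    by (simp add: differentiable_on_def Ck.simps)
  then interpret L: linear "frechet_derivative f (at x)"
    by (rule has_derivative_linear)
  have "frechet_derivative f (at x) h = grad f x \<bullet> h" for h
  proof -
    have "frechet_derivative f (at x) h = frechet_derivative f (at x) (\<Sum>i\<in>UNIV. h $ i *\<^sub>R axis i 1)"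
      by (simp add: basis_expansion scalar_mult_eq_scaleR[symmetric])
    also have "\<dots> = grad f x \<bullet> h"
      by (simp add: L.sum L.scaleR grad_def partial_def inner_vec_def mult.commute)
    finally show ?thesis .
  qed
  then have "frechet_derivative f (at x) = (\<lambda>h. grad f x \<bullet> h)" by blast
  with D show ?thesis by simp
qed

lemma Ck_Suc_continuous_on: "Ck (Suc n) f \<Longrightarrow> continuous_on S f"
  by (auto simp: Ck.simps intro: differentiable_imp_continuous_on continuous_on_subset)

lemma Ck_1_continuous_partial: "Ck (Suc 0) f \<Longrightarrow> continuous_on S (partial i f)"
  by (auto simp: Ck.simps intro: continuous_on_subset)

lemma Ck_1_continuous_grad: "Ck (Suc 0) f \<Longrightarrow> continuous_on S (grad f)"
  unfolding grad_def by (intro continuous_on_vec_lambda Ck_1_continuous_partial)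

lemma partial_eqI:
  assumes "(f has_derivative (\<lambda>h. D \<bullet> h)) (at x)"
  shows "partial i f x = D $ i"
  using fun_cong[OF frechet_derivative_at[OF assms], of "axis i 1"]
  by (simp add: partial_def inner_axis)

text \<open>The route by which the kernel and its convolutions are shown to be C^1: a derivative
  known as an inner product with \<open>D x\<close> has the components of \<open>D\<close> as its
  partial derivatives.\<close>

lemma Ck_1I:
  assumes "\<And>x. (f has_derivative (\<lambda>h. D x \<bullet> h)) (at x)" "continuous_on UNIV D"
  shows "Ck (Suc 0) f"
proof -
  have "partial i f = (\<lambda>x. D x $ i)" for i
    using partial_eqI[OF assms(1)] by (rule ext)
  moreover have "f differentiable (at x)" for x
    using assms(1) by (rule differentiableI)
  ultimately show ?thesis
    using assms(2) by (simp add: Ck.simps differentiable_on_def continuous_on_component)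
qed

lemma Ck_1_mult_has_derivative:
  assumes "Ck (Suc 0) f" "Ck (Suc 0) g"
  shows "((\<lambda>x. f x * g x) has_derivative (\<lambda>h. (f x *\<^sub>R grad g x + g x *\<^sub>R grad f x) \<bullet> h)) (at x)"
  by (rule has_derivative_eq_rhs[OF has_derivative_mult[OF assms[THEN Ck_Suc_has_derivative]]])
    (simp add: inner_add_left inner_scaleR_left algebra_simps)

lemma Ck_1_mult:
  assumes "Ck (Suc 0) f" "Ck (Suc 0) g"
  shows "Ck (Suc 0) (\<lambda>x. f x * g x)"
    and "partial i (\<lambda>x. f x * g x) x = f x * partial i g x + g x * partial i f x"
proof -
  show "Ck (Suc 0) (\<lambda>x. f x * g x)"
    using assms by (intro Ck_1I[OF Ck_1_mult_has_derivative] continuous_intros)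
      (auto intro: Ck_Suc_continuous_on[of 0] Ck_1_continuous_grad)
  show "partial i (\<lambda>x. f x * g x) x = f x * partial i g x + g x * partial i f x"
    using partial_eqI[OF Ck_1_mult_has_derivative[OF assms]] by (simp add: grad_def)
qed

lemma partial_eq_0_outside_support:
  assumes "x \<notin> closure {x. f x \<noteq> 0}"
  shows "partial i f x = 0"
proof -
  have "(f has_derivative (\<lambda>h. 0 \<bullet> h)) (at x)"
  proof (rule has_derivative_transform_within_open)
    show "((\<lambda>x. 0) has_derivative (\<lambda>h. 0 \<bullet> h)) (at x)" by simp
    show "open (- closure {x. f x \<noteq> 0})" by (intro open_Compl closed_closure)
    show "x \<in> - closure {x. f x \<noteq> 0}" using assms by simp
    show "0 = f y" if "y \<in> - closure {x. f x \<noteq> 0}" for y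
      using that closure_subset[of "{x. f x \<noteq> 0}"] by auto
  qed
  then show ?thesis using partial_eqI[of f 0 x i] by simp
qed

section \<open>Translation invariance and the integral of a partial derivative\<close>

lemma lborel_integrable_translate:
  fixes f :: "'a::euclidean_space \<Rightarrow> 'b::{banach, second_countable_topology}"
  assumes [measurable]: "f \<in> borel_measurable borel"
  shows "integrable lborel (\<lambda>x. f (x + c)) \<longleftrightarrow> integrable lborel f"
  using integrable_distr_eq[of "(+) c" lborel borel f]
  by (simp add: lborel_distr_plus add.commute)

lemma lborel_integral_translate:
  fixes f :: "'a::euclidean_space \<Rightarrow> 'b::{banach, second_countable_topology}"
  assumes [measurable]: "f \<in> borel_measurable borel"
  shows "(\<integral>x. f (x + c) \<partial>lborel) = (\<integral>x. f x \<partial>lborel)"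
  using integral_distr[of "(+) c" lborel borel f]
  by (simp add: lborel_distr_plus add.commute)

text \<open>The difference quotients of \<open>f\<close> have integral zero because Lebesgue measure is
  translation invariant.\<close>
lemma integral_partial_eq_0:
  assumes f: "Ck (Suc 0) f" and bdd: "bounded {x. f x \<noteq> 0}"
  shows "(\<integral>x. partial i f x \<partial>lborel) = 0"
proof -
  define e :: "real^3" where "e = axis i 1"
  define a :: "nat \<Rightarrow> real" where "a n = inverse (real (Suc n))" for n
  define s where "s n x = (f (x + a n *\<^sub>R e) - f x) / a n" for n x
  have e: "norm e = 1" by (simp add: e_def)
  have a: "0 < a n" "a n \<le> 1" for n by (auto simp: a_def field_simps)
  obtain R where R: "\<And>x. f x \<noteq> 0 \<Longrightarrow> norm x \<le> R"
    using bdd by (auto simp: bounded_iff)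
  have meas [measurable]: "f \<in> borel_measurable borel"
    using Ck_Suc_continuous_on[of 0 f UNIV] f by (auto intro: borel_measurable_continuous_onI)
  have meas' [measurable]: "partial i f \<in> borel_measurable borel"
    using Ck_1_continuous_partial[of f UNIV] f by (auto intro: borel_measurable_continuous_onI)
  have int_f: "integrable lborel f"
  proof -
    have "integrable lborel (\<lambda>x. indicator (cball 0 R) x *\<^sub>R f x)"
      using f by (intro borel_integrable_compact Ck_Suc_continuous_on[of 0]) auto
    also have "(\<lambda>x. indicator (cball 0 R) x *\<^sub>R f x) = f"
      using R by (force simp: indicator_def fun_eq_iff)
    finally show ?thesis .
  qed
  have shift: "integrable lborel (\<lambda>x. f (x + c))" "(\<integral>x. f (x + c) \<partial>lborel) = (\<integral>x. f x \<partial>lborel)" for c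
    using int_f meas by (simp_all add: lborel_integrable_translate lborel_integral_translate)
  have "bounded (grad f ` cball 0 (R + 2))"
    using f by (intro compact_imp_bounded compact_continuous_image Ck_1_continuous_grad) auto
  then obtain M where M: "\<And>x. norm x \<le> R + 2 \<Longrightarrow> norm (grad f x) \<le> M"
    unfolding bounded_iff by (metis imageI mem_cball_0)
  \<comment> \<open>The increments \<open>a n\<close> are at most 1. From a point of norm at most
    \<open>R + 1\<close> the segment stays in the ball of radius \<open>R + 2\<close>, where
    \<open>M\<close> bounds the gradient; farther out both values of \<open>f\<close>
    vanish.\<close>
  have lip: "norm (s n x) \<le> indicator (cball 0 (R + 1)) x * M" for n x
  proof (cases "norm x \<le> R + 1")
    case True
    have nx: "norm (x + a n *\<^sub>R e) \<le> R + 2"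
      using norm_triangle_ineq[of x "a n *\<^sub>R e"] True e a[of n] by simp
    have "norm (f (x + a n *\<^sub>R e) - f x) \<le> M * norm (x + a n *\<^sub>R e - x)"
    proof (rule differentiable_bound[of "cball 0 (R + 2)"])
      show "(f has_derivative (\<lambda>h. grad f y \<bullet> h)) (at y within cball 0 (R + 2))" for y
        by (rule has_derivative_at_withinI[OF Ck_Suc_has_derivative[OF f]])
      show "onorm (\<lambda>h. grad f y \<bullet> h) \<le> M" if "y \<in> cball 0 (R + 2)" for y
      proof (rule onorm_le)
        fix h
        have "norm (grad f y \<bullet> h) \<le> norm (grad f y) * norm h"
          using Cauchy_Schwarz_ineq2 by simp
        also have "\<dots> \<le> M * norm h"
          using M[of y] that by (intro mult_right_mono) auto
        finally show "norm (grad f y \<bullet> h) \<le> M * norm h" .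
      qed
    qed (use nx True in auto)
    then have "norm (s n x) \<le> M"
      using a[of n] e by (simp add: s_def pos_divide_le_eq)
    with True show ?thesis by simp
  next
    case False
    have "norm (x + a n *\<^sub>R e) > R"
      using norm_triangle_ineq4[of "x + a n *\<^sub>R e" "a n *\<^sub>R e"] False e a[of n] by simp
    then have "f (x + a n *\<^sub>R e) = 0" "f x = 0"
      using R[of x] R[of "x + a n *\<^sub>R e"] False by force+
    then show ?thesis using False by (simp add: s_def indicator_def)
  qed
  have lim: "(\<lambda>n. s n x) \<longlonglongrightarrow> partial i f x" for x
  proof -
    have "((\<lambda>t. f (x + t *\<^sub>R e)) has_derivative (\<lambda>t. grad f x \<bullet> (t *\<^sub>R e))) (at 0)"
    proof -
      have 1: "((\<lambda>t. x + t *\<^sub>R e) has_derivative (\<lambda>t. t *\<^sub>R e)) (at 0)"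
        by (auto intro!: derivative_eq_intros)
      have 2: "(f has_derivative (\<lambda>h. grad f x \<bullet> h)) (at (x + 0 *\<^sub>R e))"
        using f Ck_Suc_has_derivative[of 0] by simp
      show ?thesis using diff_chain_at[OF 1 2] by (simp add: o_def)
    qed
    then have "((\<lambda>t. f (x + t *\<^sub>R e)) has_field_derivative partial i f x) (at 0)"
      unfolding has_field_derivative_def
      by (rule has_derivative_eq_rhs) (simp add: e_def inner_axis grad_def fun_eq_iff)
    then have "((\<lambda>t. (f (x + t *\<^sub>R e) - f x) / t) \<longlongrightarrow> partial i f x) (at 0)"
      by (simp add: DERIV_def)
    moreover have "filterlim a (at 0) sequentially"
      unfolding filterlim_at using LIMSEQ_inverse_real_of_nat a
      by (auto simp: a_def[abs_def])
    ultimately show ?thesis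
      unfolding s_def by (rule filterlim_compose)
  qed
  have "(\<lambda>n. \<integral>x. s n x \<partial>lborel) \<longlonglongrightarrow> (\<integral>x. partial i f x \<partial>lborel)"
  proof (rule integral_dominated_convergence[where w="\<lambda>x. indicator (cball 0 (R + 1)) x * M"])
    show "integrable lborel (\<lambda>x. indicator (cball 0 (R + 1)) x * M)"
      using borel_integrable_compact[of "cball 0 (R + 1)" "\<lambda>x. M"] by simp
  qed (use lip lim in \<open>auto simp: s_def\<close>)
  moreover have "(\<integral>x. s n x \<partial>lborel) = 0" for n
    unfolding s_def using shift int_f by simp
  ultimately show ?thesis
    by (simp add: LIMSEQ_const_iff)
qed

lemma test_function_Ck: "test_function \<Omega> \<phi> \<Longrightarrow> Ck n \<phi>"
  by (simp add: test_function_def)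

text \<open>The compact support of \<phi> makes the product and its derivative vanish outside
  \<Omega>, so the integral is one over the whole space and \<open>integral_partial_eq_0\<close>
  applies.\<close>

lemma integral_by_parts:
  assumes \<Omega>: "\<Omega> \<in> sets lebesgue" and f: "Ck (Suc 0) f" and \<phi>: "test_function \<Omega> \<phi>"
  shows "(\<integral>x. f x * partial i \<phi> x + \<phi> x * partial i f x \<partial>lebesgue_on \<Omega>) = 0"
proof -
  let ?g = "\<lambda>x. f x * \<phi> x"
  have g: "Ck (Suc 0) ?g" "partial i ?g x = f x * partial i \<phi> x + \<phi> x * partial i f x" for x
    by (rule Ck_1_mult[OF f test_function_Ck[OF \<phi>]])+
  have outside: "\<phi> x = 0 \<and> partial i \<phi> x = 0" if "x \<notin> \<Omega>" for x
  proof -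
    have "x \<notin> closure {x. \<phi> x \<noteq> 0}"
      using that \<phi> by (auto simp: test_function_def)
    then show ?thesis
      using partial_eq_0_outside_support[of x \<phi>] closure_subset[of "{x. \<phi> x \<noteq> 0}"] by blast
  qed
  have "(\<integral>x. partial i ?g x \<partial>lebesgue_on \<Omega>) = (\<integral>x. (if x \<in> \<Omega> then partial i ?g x else 0) \<partial>lebesgue)"
    by (rule Lebesgue_Measure.integral_restrict_UNIV[OF \<Omega>, symmetric])
  also have "(\<lambda>x. if x \<in> \<Omega> then partial i ?g x else 0) = partial i ?g"
    using outside g(2) by (auto simp: fun_eq_iff)
  also have "(\<integral>x. partial i ?g x \<partial>lebesgue) = (\<integral>x. partial i ?g x \<partial>lborel)"
    using Ck_1_continuous_partial[OF g(1), of UNIV]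
    by (intro integral_completion) (simp add: borel_measurable_continuous_onI)
  also have "\<dots> = 0"
  proof (rule integral_partial_eq_0[OF g(1)])
    have "bounded {x. \<phi> x \<noteq> 0}"
      using \<phi> compact_imp_bounded closure_subset bounded_subset by (metis test_function_def)
    then show "bounded {x. ?g x \<noteq> 0}" by (rule bounded_subset) auto
  qed
  finally show ?thesis by (simp add: g)
qed

lemma continuous_integrable_bounded:
  fixes f :: "real^3 \<Rightarrow> 'a::euclidean_space"
  assumes "\<Omega> \<in> lmeasurable" "bounded \<Omega>" "continuous_on UNIV f"
  shows "integrable (lebesgue_on \<Omega>) f"
proof -
  have "bounded (f ` closure \<Omega>)"
    using assms
    by (intro compact_imp_bounded compact_continuous_image)
      (auto intro: continuous_on_subset simp: compact_closure)
  then obtain M where "\<And>x. x \<in> closure \<Omega> \<Longrightarrow> norm (f x) \<le> M" by (auto simp: bounded_iff)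
  moreover have "f \<in> borel_measurable (lebesgue_on \<Omega>)"
    using assms continuous_on_subset[OF assms(3)]
    by (intro continuous_imp_measurable_on_sets_lebesgue) (auto simp: fmeasurableD)
  ultimately show ?thesis
    using closure_subset[of \<Omega>]
    by (intro finite_measure.integrable_const_bound[OF finite_measure_lebesgue_on[OF assms(1)], of _ M])
      (auto intro!: AE_I2)
qed

lemma continuous_L2:
  fixes f :: "real^3 \<Rightarrow> 'a::euclidean_space"
  assumes "\<Omega> \<in> lmeasurable" "bounded \<Omega>" "continuous_on UNIV f"
  shows "f \<in> L2 \<Omega>"
proof -
  have "continuous_on UNIV (\<lambda>x. (norm (f x))\<^sup>2)"
    using assms(3) by (intro continuous_on_power continuous_on_norm)
  then show ?thesis
    unfolding L2_def mem_Collect_eq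
    by (intro conjI borel_measurable_integrable[OF continuous_integrable_bounded]
        continuous_integrable_bounded assms)
qed

lemma integral_partial_test:
  assumes "\<Omega> \<in> lmeasurable" "bounded \<Omega>" "Ck (Suc 0) f" "test_function \<Omega> \<phi>"
  shows "(\<integral>x. partial i f x * \<phi> x \<partial>lebesgue_on \<Omega>) = - (\<integral>x. f x * partial i \<phi> x \<partial>lebesgue_on \<Omega>)"
proof -
  have \<phi>: "Ck (Suc 0) \<phi>" using assms test_function_Ck by blast
  have "integrable (lebesgue_on \<Omega>) (\<lambda>x. f x * partial i \<phi> x)"
    "integrable (lebesgue_on \<Omega>) (\<lambda>x. \<phi> x * partial i f x)"
    by (intro continuous_integrable_bounded continuous_on_mult Ck_1_continuous_partial
        Ck_Suc_continuous_on[of 0] assms \<phi>)+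
  then show ?thesis
    using integral_by_parts[of \<Omega> f \<phi> i] assms by (simp add: fmeasurableD mult.commute)
qed

subsection \<open>Weak derivatives of smooth fields\<close>

lemma continuous_on_vecI:
  fixes f :: "'a::topological_space \<Rightarrow> real^'n"
  assumes "\<And>i. continuous_on S (\<lambda>x. f x $ i)"
  shows "continuous_on S f"
proof -
  have "continuous_on S (\<lambda>x. \<chi> i. f x $ i)"
    using assms by (rule continuous_on_vec_lambda)
  then show ?thesis by simp
qed

lemma curl_component:
  "curl v x $ 1 = partial 2 (\<lambda>y. v y $ 3) x - partial 3 (\<lambda>y. v y $ 2) x"
  "curl v x $ 2 = partial 3 (\<lambda>y. v y $ 1) x - partial 1 (\<lambda>y. v y $ 3) x"
  "curl v x $ 3 = partial 1 (\<lambda>y. v y $ 2) x - partial 2 (\<lambda>y. v y $ 1) x"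
  by (simp_all add: curl_def)

lemma continuous_on_curl:
  assumes "\<And>i. Ck (Suc 0) (\<lambda>x. v x $ i)"
  shows "continuous_on S (curl v)"
proof (rule continuous_on_vecI)
  fix i :: 3
  consider "i = 1" | "i = 2" | "i = 3" using exhaust_3 by blast
  then show "continuous_on S (\<lambda>x. curl v x $ i)"
    by cases (simp_all only: curl_component,
        (intro continuous_on_diff Ck_1_continuous_partial assms)+)
qed

lemma continuous_on_field:
  fixes v :: vector_field
  assumes "\<And>i. Ck (Suc 0) (\<lambda>x. v x $ i)"
  shows "continuous_on S v"
  by (intro continuous_on_vecI Ck_Suc_continuous_on[OF assms])

lemma test_field_Ck: "test_field \<Omega> \<phi> \<Longrightarrow> Ck n (\<lambda>x. \<phi> x $ i)"
  unfolding test_field_def by (blast intro: test_function_Ck)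

section \<open>C^1 fields as weakly differentiable fields on a bounded open set\<close>

locale bounded_domain =
  fixes \<Omega> :: "(real^3) set"
  assumes open_domain: "open \<Omega>" and bounded_domain: "bounded \<Omega>"
begin

lemma lmeasurable_domain: "\<Omega> \<in> lmeasurable"
  using open_domain bounded_domain by (rule lmeasurable_open[rotated])

lemmas continuous_L2 = continuous_L2[OF lmeasurable_domain bounded_domain]

lemma integrable_mult_continuous:
  fixes f g :: scalar_field
  assumes "continuous_on UNIV f" "continuous_on UNIV g"
  shows "integrable (lebesgue_on \<Omega>) (\<lambda>x. f x * g x)"
  by (intro continuous_integrable_bounded lmeasurable_domain bounded_domain continuous_on_mult assms)

lemma test_function_L2:
  assumes "test_function \<Omega> \<phi>"
  shows "\<phi> \<in> L2 \<Omega>" "grad \<phi> \<in> L2 \<Omega>"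
  using test_function_Ck[OF assms]
  by (blast intro: continuous_L2 Ck_Suc_continuous_on Ck_1_continuous_grad)+

lemma test_field_L2:
  assumes "test_field \<Omega> \<phi>"
  shows "\<phi> \<in> L2 \<Omega>" "curl \<phi> \<in> L2 \<Omega>"
  using test_field_Ck[OF assms]
  by (blast intro: continuous_L2 continuous_on_field continuous_on_curl)+

text \<open>Together with \<open>has_weak_curl_classical\<close>, this makes fields that are C^1 on
  the whole space admissible in the trace conditions, whatever their values on the boundary of
  \<Omega>.\<close>

lemma has_weak_grad_classical:
  assumes f: "Ck (Suc 0) f"
  shows "has_weak_grad \<Omega> f (grad f)"
  unfolding has_weak_grad_def
proof (intro conjI allI impI)
  show "f \<in> L2 \<Omega>" "grad f \<in> L2 \<Omega>"
    by (rule continuous_L2[OF Ck_Suc_continuous_on[OF f]] continuous_L2[OF Ck_1_continuous_grad[OF f]])+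
  fix \<phi> assume \<phi>: "test_field \<Omega> \<phi>"
  have "L2_inner \<Omega> (grad f) \<phi> = (\<Sum>i\<in>UNIV. \<integral>x. partial i f x * \<phi> x $ i \<partial>lebesgue_on \<Omega>)"
    unfolding L2_inner_def grad_def inner_vec_def
    by (simp, intro Bochner_Integration.integral_sum integrable_mult_continuous
        Ck_1_continuous_partial f Ck_Suc_continuous_on[OF test_field_Ck[OF \<phi>]])
  also have "\<dots> = (\<Sum>i\<in>UNIV. - (\<integral>x. f x * partial i (\<lambda>x. \<phi> x $ i) x \<partial>lebesgue_on \<Omega>))"
    using \<phi> by (intro sum.cong refl integral_partial_test lmeasurable_domain bounded_domain f)
      (simp add: test_field_def)
  also have "\<dots> = - (\<integral>x. (\<Sum>i\<in>UNIV. f x * partial i (\<lambda>x. \<phi> x $ i) x) \<partial>lebesgue_on \<Omega>)"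
    unfolding sum_negf
    by (intro arg_cong[where f=uminus] Bochner_Integration.integral_sum[symmetric]
        integrable_mult_continuous Ck_1_continuous_partial Ck_Suc_continuous_on[OF f] test_field_Ck[OF \<phi>])
  finally show "L2_inner \<Omega> (grad f) \<phi> = - L2_inner \<Omega> f (divergence \<phi>)"
    by (simp add: L2_inner_def divergence_def sum_distrib_left)
qed

lemma has_weak_curl_classical:
  fixes v :: vector_field
  assumes v: "\<And>i. Ck (Suc 0) (\<lambda>x. v x $ i)"
  shows "has_weak_curl \<Omega> v (curl v)"
  unfolding has_weak_curl_def
proof (intro conjI allI impI)
  show "v \<in> L2 \<Omega>" "curl v \<in> L2 \<Omega>"
    by (rule continuous_L2[OF continuous_on_field[OF v]] continuous_L2[OF continuous_on_curl[OF v]])+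
  fix \<phi> assume \<phi>: "test_field \<Omega> \<phi>"
  note cont = Ck_1_continuous_partial[OF v] Ck_1_continuous_partial[OF test_field_Ck[OF \<phi>]]
    Ck_Suc_continuous_on[OF v] Ck_Suc_continuous_on[OF test_field_Ck[OF \<phi>]]
  have int: "integrable (lebesgue_on \<Omega>) (\<lambda>x. partial i (\<lambda>y. v y $ a) x * \<phi> x $ b)"
    "integrable (lebesgue_on \<Omega>) (\<lambda>x. v x $ a * partial i (\<lambda>y. \<phi> y $ b) x)" for i a b
    by (intro integrable_mult_continuous cont)+
  have parts: "(\<integral>x. partial i (\<lambda>y. v y $ a) x * \<phi> x $ b \<partial>lebesgue_on \<Omega>)
      = - (\<integral>x. v x $ a * partial i (\<lambda>y. \<phi> y $ b) x \<partial>lebesgue_on \<Omega>)" for i a b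
    using \<phi> by (intro integral_partial_test lmeasurable_domain bounded_domain v)
      (simp add: test_field_def)
  \<comment> \<open>The minus sign of each integration by parts is absorbed by the antisymmetry of
    the curl.\<close>
  show "L2_inner \<Omega> (curl v) \<phi> = L2_inner \<Omega> v (curl \<phi>)"
    by (simp add: L2_inner_def inner_vec_def sum_3 curl_component left_diff_distrib
        right_diff_distrib int parts)
qed

lemma H1_field_classical:
  fixes v :: vector_field
  assumes v: "\<And>i. Ck (Suc 0) (\<lambda>x. v x $ i)"
  shows "v \<in> H1_field \<Omega>"
  using has_weak_grad_classical[OF v] by (auto simp: H1_field_def H1_def)

lemma has_weak_div_cong_AE:
  assumes "has_weak_div \<Omega> v d" "v' \<in> L2 \<Omega>" "d' \<in> L2 \<Omega>"
    "AE x in lebesgue_on \<Omega>. v x = v' x" "AE x in lebesgue_on \<Omega>. d x = d' x"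
  shows "has_weak_div \<Omega> v' d'"
  using assms L2_inner_cong_AE[of v \<Omega> v'] L2_inner_cong_AE[of d \<Omega> d'] test_function_L2
  by (simp add: has_weak_div_def)

lemma has_weak_curl_cong_AE:
  assumes "has_weak_curl \<Omega> v w" "v' \<in> L2 \<Omega>" "w' \<in> L2 \<Omega>"
    "AE x in lebesgue_on \<Omega>. v x = v' x" "AE x in lebesgue_on \<Omega>. w x = w' x"
  shows "has_weak_curl \<Omega> v' w'"
  using assms L2_inner_cong_AE[of v \<Omega> v'] L2_inner_cong_AE[of w \<Omega> w'] test_field_L2
  by (simp add: has_weak_curl_def)

lemma has_weak_div_add:
  assumes "has_weak_div \<Omega> v d" "has_weak_div \<Omega> v' d'"
  shows "has_weak_div \<Omega> (\<lambda>x. v x + v' x) (\<lambda>x. d x + d' x)"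
  using assms test_function_L2
  by (auto simp: has_weak_div_def L2_inner_add_left)

lemma has_weak_curl_add:
  assumes "has_weak_curl \<Omega> v w" "has_weak_curl \<Omega> v' w'"
  shows "has_weak_curl \<Omega> (\<lambda>x. v x + v' x) (\<lambda>x. w x + w' x)"
  using assms test_field_L2
  by (auto simp: has_weak_curl_def L2_inner_add_left)

end

lemma has_weak_div_scaleR:
  "has_weak_div \<Omega> v d \<Longrightarrow> has_weak_div \<Omega> (\<lambda>x. c *\<^sub>R v x) (\<lambda>x. c *\<^sub>R d x)"
  by (auto simp: has_weak_div_def L2_inner_scaleR_left simp del: real_scaleR_def)

lemma has_weak_curl_scaleR:
  "has_weak_curl \<Omega> v w \<Longrightarrow> has_weak_curl \<Omega> (\<lambda>x. c *\<^sub>R v x) (\<lambda>x. c *\<^sub>R w x)"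
  by (auto simp: has_weak_curl_def L2_inner_scaleR_left)

subsection \<open>The mollifying kernel\<close>

text \<open>Squaring the positive part makes this polynomial cut-off C^1 across the sphere of radius
  \<open>r\<close>. It is not normalised; \<open>bump_mass\<close> is divided out only in the limit
  argument.\<close>

definition bump :: "real \<Rightarrow> real^3 \<Rightarrow> real" where
  "bump r z = (max 0 (r\<^sup>2 - (norm z)\<^sup>2))\<^sup>2"

text \<open>The gradient of \<open>bump r\<close>: the factor 4 is 2 from the outer square times 2
  from the squared norm.\<close>

definition bump_grad :: "real \<Rightarrow> real^3 \<Rightarrow> real^3" where
  "bump_grad r z = - (4 * max 0 (r\<^sup>2 - (norm z)\<^sup>2)) *\<^sub>R z"

lemma bump_minus [simp]: "bump r (- z) = bump r z" "bump_grad r (- z) = - bump_grad r z"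
  by (simp_all add: bump_def bump_grad_def)

lemma bump_diff_commute: "bump r (x - y) = bump r (y - x)" "bump_grad r (x - y) = - bump_grad r (y - x)"
  using bump_minus[of r "y - x"] by simp_all

lemma continuous_on_bump: "continuous_on S (bump r)" "continuous_on S (bump_grad r)"
  unfolding bump_def[abs_def] bump_grad_def[abs_def] by (intro continuous_intros)+

lemma bump_nonneg: "0 \<le> bump r z"
  by (simp add: bump_def)

lemma bump_le: "bump r z \<le> r ^ 4"
proof -
  have "bump r z \<le> (r\<^sup>2)\<^sup>2"
    unfolding bump_def by (intro power_mono) auto
  then show ?thesis by simp
qed

lemma bump_eq_0: "0 < r \<Longrightarrow> r \<le> norm z \<Longrightarrow> bump r z = 0"
  by (simp add: bump_def max_def power_mono)

lemma bump_pos: "norm z < r \<Longrightarrow> 0 < bump r z"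
  using power_strict_mono[of "norm z" r 2] by (simp add: bump_def max_def)

lemma norm_bump_grad_le:
  assumes "0 < r" shows "norm (bump_grad r z) \<le> 4 * r ^ 3"
proof (cases "norm z \<le> r")
  case True
  have "norm (bump_grad r z) = 4 * max 0 (r\<^sup>2 - (norm z)\<^sup>2) * norm z"
    by (simp add: bump_grad_def)
  also have "\<dots> \<le> 4 * r\<^sup>2 * r"
    using True assms by (intro mult_mono) auto
  finally show ?thesis by (simp add: power2_eq_square power3_eq_cube)
next
  case False
  then have "r\<^sup>2 \<le> (norm z)\<^sup>2" using assms by (intro power_mono) auto
  then show ?thesis using assms by (simp add: bump_grad_def)
qed

text \<open>The square of the positive part has derivative \<open>2 * max 0 t\<close>, which is
  2-Lipschitz, so an increment \<open>s\<close> leaves a remainder of at most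
  \<open>s\<^sup>2\<close>. The first constant bounds \<open>s\<close> in terms of \<open>h\<close>;
  the second comes from the part of \<open>s\<close> that is quadratic in \<open>h\<close>,
  multiplied by \<open>2 * max 0 t\<close>. The constants are uniform for \<open>z\<close> in a
  bounded set, which is what differentiation under the integral requires.\<close>

lemma bump_taylor:
  assumes "norm h \<le> 1"
  shows "\<bar>bump r (z + h) - bump r z - bump_grad r z \<bullet> h\<bar> \<le> ((2 * norm z + 1)\<^sup>2 + 2 * r\<^sup>2) * (norm h)\<^sup>2"
proof -
  define t where "t = r\<^sup>2 - (norm z)\<^sup>2"
  define s where "s = - 2 * (z \<bullet> h) - (norm h)\<^sup>2"
  have ts: "r\<^sup>2 - (norm (z + h))\<^sup>2 = t + s"
    by (simp add: t_def s_def power2_norm_eq_inner inner_simps inner_commute)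
  have sq: "\<bar>(max 0 (t + s))\<^sup>2 - (max 0 t)\<^sup>2 - 2 * max 0 t * s\<bar> \<le> s\<^sup>2"
  proof (cases "t \<ge> 0")
    case t: True
    show ?thesis
    proof (cases "t + s \<ge> 0")
      case True
      then show ?thesis using t by (simp add: max_def power2_eq_square algebra_simps)
    next
      case False
      \<comment> \<open>The positive part vanishes at \<open>t + s\<close>, so the remainder is
        \<open>- (t\<^sup>2 + 2 * t * s)\<close>. The first inequality bounds it above by
        \<open>s\<^sup>2\<close>, the second makes it nonnegative.\<close>
      have "t\<^sup>2 + 2 * t * s + s\<^sup>2 \<ge> 0" "t\<^sup>2 + 2 * t * s \<le> 0"
        using sum_power2_ge_zero[of "t + s" 0] mult_nonneg_nonpos[of t "t + s"]
          mult_nonneg_nonpos[of t "s"] False t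
        by (auto simp: power2_eq_square algebra_simps)
      then show ?thesis using False t by (simp add: max_def abs_if)
    qed
  next
    case False
    show ?thesis
    proof (cases "t + s \<ge> 0")
      case True
      then have "(t + s)\<^sup>2 \<le> s\<^sup>2" using False by (intro power_mono) auto
      then show ?thesis using True False by (simp add: max_def)
    qed (use False in \<open>simp add: max_def\<close>)
  qed
  have "\<bar>s\<bar> \<le> 2 * (norm z * norm h) + norm h * norm h"
    using Cauchy_Schwarz_ineq2[of z h] zero_le_square[of "norm h"]
    unfolding s_def power2_eq_square abs_le_iff by linarith
  also have "\<dots> \<le> (2 * norm z + 1) * norm h"
    using assms mult_right_mono[of "norm h" 1 "norm h"] by (simp add: algebra_simps)
  finally have "\<bar>s\<bar>\<^sup>2 \<le> ((2 * norm z + 1) * norm h)\<^sup>2"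
    by (intro power_mono) auto
  then have s: "s\<^sup>2 \<le> (2 * norm z + 1)\<^sup>2 * (norm h)\<^sup>2"
    by (simp add: power_mult_distrib)
  have "max 0 t * (norm h)\<^sup>2 \<le> r\<^sup>2 * (norm h)\<^sup>2"
    by (intro mult_right_mono) (auto simp: t_def)
  moreover have "0 \<le> max 0 t * (norm h)\<^sup>2" by simp
  moreover have "bump r (z + h) - bump r z - bump_grad r z \<bullet> h
      = ((max 0 (t + s))\<^sup>2 - (max 0 t)\<^sup>2 - 2 * max 0 t * s) - 2 * (max 0 t * (norm h)\<^sup>2)"
    unfolding bump_def bump_grad_def ts t_def[symmetric] by (simp add: s_def algebra_simps)
  moreover have "((2 * norm z + 1)\<^sup>2 + 2 * r\<^sup>2) * (norm h)\<^sup>2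
      = (2 * norm z + 1)\<^sup>2 * (norm h)\<^sup>2 + 2 * (r\<^sup>2 * (norm h)\<^sup>2)"
    by (simp add: algebra_simps)
  ultimately show ?thesis
    using sq s by (simp only: abs_le_iff) linarith
qed

text \<open>A remainder bound with an explicit constant can be integrated, so the same criterion
  serves for the kernel and for its convolutions.\<close>

lemma has_derivative_quadratic_remainder:
  fixes f :: "'a::real_inner \<Rightarrow> real"
  assumes "\<And>h. norm h \<le> 1 \<Longrightarrow> \<bar>f (x + h) - f x - D \<bullet> h\<bar> \<le> C * (norm h)\<^sup>2"
  shows "(f has_derivative (\<lambda>h. D \<bullet> h)) (at x)"
  unfolding has_derivative_at
proof (intro conjI)
  show "bounded_linear (\<lambda>h. D \<bullet> h)" by (rule bounded_linear_inner_right)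
  show "(\<lambda>h. norm (f (x + h) - f x - D \<bullet> h) / norm h) \<midarrow>0\<rightarrow> 0"
  proof (rule Lim_null_comparison)
    have "eventually (\<lambda>h. norm h < 1) (at (0::'a))"
      unfolding eventually_at by (intro exI[of _ 1]) simp
    then show "\<forall>\<^sub>F h in at 0. norm (norm (f (x + h) - f x - D \<bullet> h) / norm h) \<le> C * norm h"
    proof (rule eventually_mono)
      fix h :: 'a assume "norm h < 1"
      then show "norm (norm (f (x + h) - f x - D \<bullet> h) / norm h) \<le> C * norm h"
        using assms[of h] by (cases "h = 0") (auto simp: power2_eq_square field_simps)
    qed
    show "((\<lambda>h. C * norm h) \<longlongrightarrow> 0) (at (0::'a))"
      by (auto intro!: tendsto_eq_intros)
  qed
qed

lemma bump_translate_has_derivative: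
  "((\<lambda>y. bump r (y - x)) has_derivative (\<lambda>h. bump_grad r (y - x) \<bullet> h)) (at y)"
proof (rule has_derivative_quadratic_remainder)
  fix h :: "real^3" assume "norm h \<le> 1"
  then show "\<bar>bump r (y + h - x) - bump r (y - x) - bump_grad r (y - x) \<bullet> h\<bar>
      \<le> ((2 * norm (y - x) + 1)\<^sup>2 + 2 * r\<^sup>2) * (norm h)\<^sup>2"
    using bump_taylor[of h r "y - x"] by (simp only: add_diff_eq diff_add_eq)
qed

lemma bump_translate_Ck: "Ck (Suc 0) (\<lambda>y. bump r (y - x))"
proof (rule Ck_1I[OF bump_translate_has_derivative])
  show "continuous_on UNIV (\<lambda>y. bump_grad r (y - x))"
    by (intro continuous_on_compose2[OF continuous_on_bump(2)] continuous_intros) auto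
qed

section \<open>The mass of the kernel\<close>

definition bump_mass :: "real \<Rightarrow> real" where
  "bump_mass r = (\<integral>z. bump r z \<partial>lborel)"

lemma bump_measurable [measurable]: "bump r \<in> borel_measurable borel" "bump_grad r \<in> borel_measurable borel"
  by (simp_all add: borel_measurable_continuous_onI continuous_on_bump)

lemma integrable_bump: "0 < r \<Longrightarrow> integrable lborel (bump r)"
proof -
  assume r: "0 < r"
  have "integrable lborel (\<lambda>x. indicator (cball 0 r) x *\<^sub>R bump r x)"
    by (intro borel_integrable_compact continuous_on_bump) auto
  also have "(\<lambda>x. indicator (cball 0 r) x *\<^sub>R bump r x) = bump r"
    using bump_eq_0[OF r] by (auto simp: indicator_def fun_eq_iff not_le)
  finally show ?thesis .
qed

text \<open>A nonnegative kernel of integral 0 would vanish almost everywhere, but this one is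
  positive on a ball. Positivity permits the normalisation.\<close>

lemma bump_mass_pos:
  assumes "0 < r" shows "0 < bump_mass r"
proof -
  have "0 \<le> bump_mass r" unfolding bump_mass_def by (simp add: bump_nonneg)
  moreover have "bump_mass r \<noteq> 0"
  proof
    assume "bump_mass r = 0"
    then have "AE z in lborel. bump r z = 0"
      using integral_nonneg_eq_0_iff_AE[OF integrable_bump[OF assms]] bump_nonneg
      by (simp add: bump_mass_def)
    then have "AE z in lborel. z \<notin> ball (0::real^3) r"
    proof (rule eventually_mono)
      show "z \<notin> ball (0::real^3) r" if "bump r z = 0" for z
        using bump_pos[of z r] that by auto
    qed
    then have "AE z in lebesgue. z \<notin> ball (0::real^3) r"
      by (rule AE_completion)
    then have "negligible (ball (0::real^3) r)"
      by (simp add: AE_iff_null_sets negligible_iff_null_sets)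
    then show False using assms open_not_negligible[of "ball (0::real^3) r"] by simp
  qed
  ultimately show ?thesis by simp
qed

lemma integral_bump_translate:
  assumes "0 < r"
  shows "integrable lebesgue (\<lambda>y. bump r (x - y))" "(\<integral>y. bump r (x - y) \<partial>lebesgue) = bump_mass r"
  using lborel_integrable_translate[of "bump r" "- x"] lborel_integral_translate[of "bump r" "- x"]
    integrable_bump[OF assms]
  by (simp_all add: bump_diff_commute(1)[of r x] integrable_completion integral_completion bump_mass_def)

text \<open>The unnormalised convolution of the kernel with the extension of \<open>f\<close> by
  zero, taken at all points of space. Near the boundary part of the kernel falls outside
  \<Omega>.\<close>

definition mollify :: "(real^3) set \<Rightarrow> real \<Rightarrow> (real^3 \<Rightarrow> 'a::euclidean_space) \<Rightarrow> real^3 \<Rightarrow> 'a" where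
  "mollify \<Omega> r f x = (\<integral>y. bump r (x - y) *\<^sub>R f y \<partial>lebesgue_on \<Omega>)"

section \<open>Mollifications are continuously differentiable\<close>

context bounded_domain
begin

lemma sets_domain [simp]: "\<Omega> \<in> sets lebesgue"
  using lmeasurable_domain by (rule fmeasurableD)

lemma continuous_measurable:
  fixes g :: "real^3 \<Rightarrow> 'b::euclidean_space"
  shows "continuous_on UNIV g \<Longrightarrow> g \<in> borel_measurable (lebesgue_on \<Omega>)"
  by (intro continuous_imp_measurable_on_sets_lebesgue) (auto intro: continuous_on_subset)

lemma bump_domain_measurable:
  "(\<lambda>y. bump r (x - y)) \<in> borel_measurable (lebesgue_on \<Omega>)"
  "(\<lambda>y. bump_grad r (x - y)) \<in> borel_measurable (lebesgue_on \<Omega>)"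
  by (intro continuous_measurable continuous_on_compose2[OF continuous_on_bump(1)[of UNIV]]
      continuous_on_compose2[OF continuous_on_bump(2)[of UNIV]] continuous_intros subset_UNIV)+

lemma L2_imp_integrable:
  assumes "f \<in> L2 \<Omega>" shows "integrable (lebesgue_on \<Omega>) f"
proof (rule Bochner_Integration.integrable_bound)
  interpret finite_measure "lebesgue_on \<Omega>"
    by (rule finite_measure_lebesgue_on[OF lmeasurable_domain])
  show "integrable (lebesgue_on \<Omega>) (\<lambda>x. (norm (f x))\<^sup>2 + 1)"
    using L2_integrable[OF assms] by simp
  have "norm (f x) \<le> (norm (f x))\<^sup>2 + 1" for x
    using sum_squares_bound[of "norm (f x)" 1] norm_ge_zero[of "f x"] unfolding one_power2 mult_1_right by linarith
  then show "AE x in lebesgue_on \<Omega>. norm (f x) \<le> norm ((norm (f x))\<^sup>2 + 1)"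
    by (intro AE_I2) (simp add: abs_of_nonneg)
qed (use assms in \<open>rule L2_measurable\<close>)

lemma integrable_bump_scaleR:
  fixes f :: "real^3 \<Rightarrow> 'a::euclidean_space"
  assumes "f \<in> L2 \<Omega>"
  shows "integrable (lebesgue_on \<Omega>) (\<lambda>y. bump r (x - y) *\<^sub>R f y)"
proof (rule Bochner_Integration.integrable_bound)
  show "integrable (lebesgue_on \<Omega>) (\<lambda>y. r ^ 4 * norm (f y))"
    using L2_imp_integrable[OF assms] by simp
  show "(\<lambda>y. bump r (x - y) *\<^sub>R f y) \<in> borel_measurable (lebesgue_on \<Omega>)"
    by (intro borel_measurable_scaleR bump_domain_measurable L2_measurable[OF assms])
  show "AE y in lebesgue_on \<Omega>. norm (bump r (x - y) *\<^sub>R f y) \<le> norm (r ^ 4 * norm (f y))"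
    using bump_le[of r] bump_nonneg[of r] by (intro AE_I2) (auto simp: abs_mult intro!: mult_right_mono)
qed

lemma norm_scaleR_bump_grad_le:
  "0 < r \<Longrightarrow> norm (f y *\<^sub>R bump_grad r (x - y)) \<le> 4 * r ^ 3 * \<bar>f y\<bar>"
  using norm_bump_grad_le[of r "x - y"] by (simp add: mult.commute mult_left_mono)

lemma integrable_scaleR_bump_grad:
  fixes f :: scalar_field
  assumes "f \<in> L2 \<Omega>" "0 < r"
  shows "integrable (lebesgue_on \<Omega>) (\<lambda>y. f y *\<^sub>R bump_grad r (x - y))"
proof (rule Bochner_Integration.integrable_bound)
  show "integrable (lebesgue_on \<Omega>) (\<lambda>y. 4 * r ^ 3 * \<bar>f y\<bar>)"
    using L2_imp_integrable[OF assms(1)] by simp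
  show "(\<lambda>y. f y *\<^sub>R bump_grad r (x - y)) \<in> borel_measurable (lebesgue_on \<Omega>)"
    by (intro borel_measurable_scaleR bump_domain_measurable L2_measurable[OF assms(1)])
  show "AE y in lebesgue_on \<Omega>. norm (f y *\<^sub>R bump_grad r (x - y)) \<le> norm (4 * r ^ 3 * \<bar>f y\<bar>)"
    using norm_scaleR_bump_grad_le[OF assms(2)] by (intro AE_I2) (metis abs_ge_self order_trans real_norm_def)
qed

text \<open>Differentiation under the integral: the quadratic remainder of the kernel, uniform over
  \<Omega>, is integrated against the absolute value of \<open>f\<close>.\<close>

lemma mollify_has_derivative:
  fixes f :: scalar_field
  assumes f: "f \<in> L2 \<Omega>" and r: "0 < r"
  shows "(mollify \<Omega> r f has_derivative (\<lambda>h. (\<integral>y. f y *\<^sub>R bump_grad r (x - y) \<partial>lebesgue_on \<Omega>) \<bullet> h)) (at x)"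
proof -
  obtain R where R: "\<And>y. y \<in> \<Omega> \<Longrightarrow> norm y \<le> R"
    using bounded_domain by (auto simp: bounded_iff)
  \<comment> \<open>The constant of \<open>bump_taylor\<close> at \<open>x - y\<close>, with
    \<open>norm (x - y)\<close> replaced by its bound \<open>norm x + R\<close> over
    \<Omega>.\<close>
  define C where "C = (2 * (norm x + R) + 1)\<^sup>2 + 2 * r\<^sup>2"
  let ?L = "lebesgue_on \<Omega>"
  show ?thesis
  proof (rule has_derivative_quadratic_remainder)
    fix h :: "real^3" assume h: "norm h \<le> 1"
    let ?rem = "\<lambda>y. bump r (x + h - y) - bump r (x - y) - bump_grad r (x - y) \<bullet> h"
    note int = integrable_bump_scaleR[OF f, of r, simplified] integrable_scaleR_bump_grad[OF f r]
    have int3: "integrable ?L (\<lambda>y. f y *\<^sub>R bump_grad r (x - y) \<bullet> h)"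
      using int(2) by (rule integrable_inner_left)
    have rem: "?rem y * f y = bump r (x + h - y) * f y - bump r (x - y) * f y - f y *\<^sub>R bump_grad r (x - y) \<bullet> h" for y
      by (simp add: algebra_simps)
    have "mollify \<Omega> r f (x + h) - mollify \<Omega> r f x - (\<integral>y. f y *\<^sub>R bump_grad r (x - y) \<partial>?L) \<bullet> h
        = (\<integral>y. ?rem y * f y \<partial>?L)"
      unfolding rem mollify_def integral_inner_left[OF int(2), symmetric]
      using int(1) int3 by simp
    also have "\<bar>\<dots>\<bar> \<le> (\<integral>y. C * (norm h)\<^sup>2 * \<bar>f y\<bar> \<partial>?L)"
    proof -
      have "norm (\<integral>y. ?rem y * f y \<partial>?L) \<le> (\<integral>y. norm (?rem y * f y) \<partial>?L)"
        by (rule integral_norm_bound)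
      also have "\<dots> \<le> (\<integral>y. C * (norm h)\<^sup>2 * \<bar>f y\<bar> \<partial>?L)"
      proof (rule integral_mono)
        show "integrable ?L (\<lambda>y. norm (?rem y * f y))"
          unfolding rem using int(1) int3
          by (intro integrable_norm Bochner_Integration.integrable_diff) auto
        show "integrable ?L (\<lambda>y. C * (norm h)\<^sup>2 * \<bar>f y\<bar>)"
          using L2_imp_integrable[OF f] by simp
        fix y assume "y \<in> space ?L"
        then have "norm (x - y) \<le> norm x + R"
          using R[of y] norm_triangle_ineq4[of x y] by simp
        then have "(2 * norm (x - y) + 1)\<^sup>2 + 2 * r\<^sup>2 \<le> C"
          unfolding C_def by (intro add_right_mono power_mono) auto
        then have "((2 * norm (x - y) + 1)\<^sup>2 + 2 * r\<^sup>2) * (norm h)\<^sup>2 \<le> C * (norm h)\<^sup>2"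
          by (rule mult_right_mono) simp
        moreover have "\<bar>?rem y\<bar> \<le> ((2 * norm (x - y) + 1)\<^sup>2 + 2 * r\<^sup>2) * (norm h)\<^sup>2"
          using bump_taylor[OF h, of r "x - y"] by (simp only: diff_add_eq)
        ultimately have "\<bar>?rem y\<bar> \<le> C * (norm h)\<^sup>2" by linarith
        then show "norm (?rem y * f y) \<le> C * (norm h)\<^sup>2 * \<bar>f y\<bar>"
          unfolding real_norm_def abs_mult by (rule mult_right_mono) simp
      qed
      finally show ?thesis by simp
    qed
    finally show "\<bar>mollify \<Omega> r f (x + h) - mollify \<Omega> r f x - (\<integral>y. f y *\<^sub>R bump_grad r (x - y) \<partial>?L) \<bullet> h\<bar>
        \<le> (C * (\<integral>y. \<bar>f y\<bar> \<partial>?L)) * (norm h)\<^sup>2"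
      by (simp add: mult_ac)
  qed
qed

lemma continuous_mollify_grad:
  fixes f :: scalar_field
  assumes f: "f \<in> L2 \<Omega>" and r: "0 < r"
  shows "continuous_on UNIV (\<lambda>x. \<integral>y. f y *\<^sub>R bump_grad r (x - y) \<partial>lebesgue_on \<Omega>)"
  unfolding continuous_on_sequentially
proof (intro allI impI ballI, elim conjE)
  fix X :: "nat \<Rightarrow> real^3" and x assume X: "X \<longlonglongrightarrow> x"
  have "(\<lambda>n. \<integral>y. f y *\<^sub>R bump_grad r (X n - y) \<partial>lebesgue_on \<Omega>)
      \<longlonglongrightarrow> (\<integral>y. f y *\<^sub>R bump_grad r (x - y) \<partial>lebesgue_on \<Omega>)"
  proof (rule integral_dominated_convergence[where w="\<lambda>y. 4 * r ^ 3 * \<bar>f y\<bar>"])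
    show "integrable (lebesgue_on \<Omega>) (\<lambda>y. 4 * r ^ 3 * \<bar>f y\<bar>)"
      using L2_imp_integrable[OF f] by simp
    show "AE y in lebesgue_on \<Omega>. norm (f y *\<^sub>R bump_grad r (X n - y)) \<le> 4 * r ^ 3 * \<bar>f y\<bar>" for n
      by (intro AE_I2 norm_scaleR_bump_grad_le r)
    have "(\<lambda>n. bump_grad r (X n - y)) \<longlonglongrightarrow> bump_grad r (x - y)" for y
      using continuous_on_bump(2)[of UNIV r] X
      by (intro continuous_on_tendsto_compose[of UNIV "bump_grad r"] tendsto_intros) auto
    then show "AE y in lebesgue_on \<Omega>. (\<lambda>n. f y *\<^sub>R bump_grad r (X n - y)) \<longlonglongrightarrow> f y *\<^sub>R bump_grad r (x - y)"
      by (intro AE_I2 tendsto_intros)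
  qed (intro borel_measurable_scaleR bump_domain_measurable L2_measurable[OF f])+
  then show "((\<lambda>x. \<integral>y. f y *\<^sub>R bump_grad r (x - y) \<partial>lebesgue_on \<Omega>) \<circ> X)
      \<longlonglongrightarrow> (\<integral>y. f y *\<^sub>R bump_grad r (x - y) \<partial>lebesgue_on \<Omega>)"
    by (simp add: o_def)
qed

lemma mollify_Ck:
  fixes f :: scalar_field
  assumes "f \<in> L2 \<Omega>" "0 < r"
  shows "Ck (Suc 0) (mollify \<Omega> r f)"
  using Ck_1I[OF mollify_has_derivative[OF assms] continuous_mollify_grad[OF assms]] .

lemma partial_mollify:
  fixes f :: scalar_field
  assumes "f \<in> L2 \<Omega>" "0 < r"
  shows "partial i (mollify \<Omega> r f) x = (\<integral>y. f y * bump_grad r (x - y) $ i \<partial>lebesgue_on \<Omega>)"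
    and "integrable (lebesgue_on \<Omega>) (\<lambda>y. f y * bump_grad r (x - y) $ i)"
  using partial_eqI[OF mollify_has_derivative[OF assms], of i x]
    integral_bounded_linear[OF bounded_linear_vec_nth[of i] integrable_scaleR_bump_grad[OF assms, of x]]
    integrable_bounded_linear[OF bounded_linear_vec_nth[of i] integrable_scaleR_bump_grad[OF assms, of x]]
  by simp_all

lemma L2_component:
  fixes v :: "real^3 \<Rightarrow> real^'n"
  assumes "v \<in> L2 \<Omega>" shows "(\<lambda>x. v x $ i) \<in> L2 \<Omega>"
proof -
  have meas: "(\<lambda>x. v x $ i) \<in> borel_measurable (lebesgue_on \<Omega>)"
    using L2_measurable[OF assms]
    by (rule measurable_compose) (intro borel_measurable_continuous_onI continuous_intros)
  have "integrable (lebesgue_on \<Omega>) (\<lambda>x. (norm (v x $ i))\<^sup>2)"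
  proof (rule Bochner_Integration.integrable_bound[OF L2_integrable[OF assms]])
    show "(\<lambda>x. (norm (v x $ i))\<^sup>2) \<in> borel_measurable (lebesgue_on \<Omega>)"
      using meas by measurable
    show "AE x in lebesgue_on \<Omega>. norm ((norm (v x $ i))\<^sup>2) \<le> norm ((norm (v x))\<^sup>2)"
      by (intro AE_I2) (simp add: abs_le_square_iff[symmetric] component_le_norm_cart)
  qed
  with meas show ?thesis by (simp add: L2_def)
qed

lemma mollify_component:
  fixes v :: "real^3 \<Rightarrow> real^'n"
  assumes "v \<in> L2 \<Omega>"
  shows "mollify \<Omega> r v x $ i = mollify \<Omega> r (\<lambda>y. v y $ i) x"
  using integral_bounded_linear[OF bounded_linear_vec_nth[of i] integrable_bump_scaleR[OF assms, of r x]]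
  by (simp add: mollify_def)

lemma mollify_field_Ck:
  fixes v :: vector_field
  assumes "v \<in> L2 \<Omega>" "0 < r"
  shows "Ck (Suc 0) (\<lambda>x. mollify \<Omega> r v x $ i)"
  using mollify_Ck[OF L2_component[OF assms(1)] assms(2)] by (simp add: mollify_component[OF assms(1)])

text \<open>Up to the boundary: the zero trace of \<open>v\<close>, tested with the translated kernel,
  removes the boundary term even where the support of the kernel leaves the domain.\<close>
lemma curl_mollify:
  assumes v: "zero_tangential_trace \<Omega> v" "has_weak_curl \<Omega> v w" and r: "0 < r"
  shows "curl (mollify \<Omega> r v) x = mollify \<Omega> r w x"
proof -
  note L2 = has_weak_curl_L2[OF v(2)]
  note vL2 = L2_component[OF L2(1)]
  \<comment> \<open>Testing with the kernel centred at \<open>x\<close> times the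
    \<open>k\<close>-th unit vector extracts the \<open>k\<close>-th component of the mollified curl
    at \<open>x\<close>.\<close>
  define \<phi> :: "3 \<Rightarrow> vector_field" where "\<phi> k y = bump r (y - x) *\<^sub>R axis k 1" for k y
  have \<phi>_nth: "(\<lambda>y. \<phi> k y $ j) = (if j = k then (\<lambda>y. bump r (y - x)) else (\<lambda>y. 0))" for j k
    by (auto simp: \<phi>_def axis_def fun_eq_iff)
  have zero: "((\<lambda>y. 0::real) has_derivative (\<lambda>h. 0 \<bullet> h)) (at y)" for y :: "real^3"
    by simp
  have \<phi>_Ck: "Ck (Suc 0) (\<lambda>y. \<phi> k y $ j)" for k j
    unfolding \<phi>_nth by (auto intro: bump_translate_Ck Ck_1I[OF zero])
  have p\<phi>: "partial i (\<lambda>y. \<phi> k y $ j) y = (if j = k then - bump_grad r (x - y) $ i else 0)" for i j k y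
    unfolding \<phi>_nth
    using partial_eqI[OF bump_translate_has_derivative[of r x y]] partial_eqI[OF zero]
    by (auto simp: bump_diff_commute(2)[of r x y])
  have trace: "L2_inner \<Omega> w (\<phi> k) = L2_inner \<Omega> v (curl (\<phi> k))" for k
    using v H1_field_classical[OF \<phi>_Ck] has_weak_curl_classical[OF \<phi>_Ck]
    by (auto simp: zero_tangential_trace_def)
  have w: "L2_inner \<Omega> w (\<phi> k) = mollify \<Omega> r w x $ k" for k
    unfolding mollify_component[OF L2(2)]
    by (simp add: L2_inner_def mollify_def \<phi>_def inner_axis bump_diff_commute(1)[of r x] mult.commute)
  have p: "partial i (\<lambda>y. mollify \<Omega> r v y $ j) x = (\<integral>y. v y $ j * bump_grad r (x - y) $ i \<partial>lebesgue_on \<Omega>)" for i j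
    unfolding mollify_component[OF L2(1)] by (rule partial_mollify(1)[OF vL2 r])
  \<comment> \<open>The test field is differentiated in \<open>y\<close>, the mollification in
    \<open>x\<close>; the resulting sign is cancelled by the antisymmetry of the curl.\<close>
  have "curl (mollify \<Omega> r v) x $ k = L2_inner \<Omega> v (curl (\<phi> k))" for k
  proof -
    consider "k = 1" | "k = 2" | "k = 3" using exhaust_3 by blast
    then show ?thesis
      by cases (simp_all add: curl_component p L2_inner_def inner_vec_def sum_3 p\<phi>
          partial_mollify(2)[OF vL2 r])
  qed
  then show ?thesis by (simp add: vec_eq_iff trace[symmetric] w)
qed

end

subsection \<open>Green's formula for the curl\<close>

text \<open>Essential boundedness, and essential continuity at almost every point. The inner
  quantifier is also almost everywhere because fields are only determined up to null sets.\<close>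

definition regulated :: "(real^3) set \<Rightarrow> (real^3 \<Rightarrow> 'a::euclidean_space) \<Rightarrow> bool" where
  "regulated \<Omega> f \<longleftrightarrow> f \<in> L2 \<Omega> \<and> (\<exists>M. AE x in lebesgue_on \<Omega>. norm (f x) \<le> M) \<and>
     (AE x in lebesgue_on \<Omega>. \<forall>e>0. \<exists>d>0. AE y in lebesgue_on \<Omega>. dist x y < d \<longrightarrow> norm (f y - f x) \<le> e)"

section \<open>Convergence of mollifications on the domain\<close>

context bounded_domain
begin

lemma bump_domain_integrable:
  assumes "0 < r" shows "integrable (lebesgue_on \<Omega>) (\<lambda>y. bump r (x - y))"
  using integrable_mult_indicator[OF sets_domain integral_bump_translate(1)[OF assms, of x]]
  by (simp add: integrable_restrict_space)

lemma integral_bump_domain_le: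
  assumes "0 < r" shows "(\<integral>y. bump r (x - y) \<partial>lebesgue_on \<Omega>) \<le> bump_mass r"
proof -
  have "(\<integral>y. bump r (x - y) \<partial>lebesgue_on \<Omega>) = (\<integral>y. indicator \<Omega> y *\<^sub>R bump r (x - y) \<partial>lebesgue)"
    by (simp add: integral_restrict_space)
  also have "\<dots> \<le> (\<integral>y. bump r (x - y) \<partial>lebesgue)"
    by (intro integral_mono integrable_mult_indicator[OF sets_domain] integral_bump_translate(1)[OF assms])
      (simp add: indicator_def bump_nonneg)
  finally show ?thesis by (simp add: integral_bump_translate(2)[OF assms])
qed

lemma integral_bump_domain_eq:
  assumes "0 < r" "ball x r \<subseteq> \<Omega>"
  shows "(\<integral>y. bump r (x - y) \<partial>lebesgue_on \<Omega>) = bump_mass r"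
proof -
  have "(\<integral>y. bump r (x - y) \<partial>lebesgue_on \<Omega>) = (\<integral>y. indicator \<Omega> y *\<^sub>R bump r (x - y) \<partial>lebesgue)"
    by (simp add: integral_restrict_space)
  also have "(\<lambda>y. indicator \<Omega> y *\<^sub>R bump r (x - y)) = (\<lambda>y. bump r (x - y))"
    using assms bump_eq_0[OF assms(1)] by (force simp: indicator_def fun_eq_iff dist_norm)
  finally show ?thesis by (simp add: integral_bump_translate(2)[OF assms(1)])
qed

text \<open>The kernel is nonnegative and its mass on \<Omega> never exceeds the full mass. After
  normalisation the bound is independent of \<open>r\<close> and yields the dominating function for
  the limit.\<close>

lemma norm_mollify_le:
  fixes f :: "real^3 \<Rightarrow> 'a::euclidean_space"
  assumes f: "f \<in> L2 \<Omega>" and r: "0 < r" and M: "AE y in lebesgue_on \<Omega>. norm (f y) \<le> M" "0 \<le> M"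
  shows "norm (mollify \<Omega> r f x) \<le> M * bump_mass r"
proof -
  have "norm (mollify \<Omega> r f x) \<le> (\<integral>y. norm (bump r (x - y) *\<^sub>R f y) \<partial>lebesgue_on \<Omega>)"
    unfolding mollify_def by (rule integral_norm_bound)
  also have "\<dots> \<le> (\<integral>y. M * bump r (x - y) \<partial>lebesgue_on \<Omega>)"
  proof (rule integral_mono_AE)
    show "integrable (lebesgue_on \<Omega>) (\<lambda>y. norm (bump r (x - y) *\<^sub>R f y))"
      by (intro integrable_norm integrable_bump_scaleR f)
    show "integrable (lebesgue_on \<Omega>) (\<lambda>y. M * bump r (x - y))"
      using bump_domain_integrable[OF r] by simp
    show "AE y in lebesgue_on \<Omega>. norm (bump r (x - y) *\<^sub>R f y) \<le> M * bump r (x - y)"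
      using M(1) by eventually_elim (simp add: bump_nonneg mult.commute mult_right_mono)
  qed
  also have "\<dots> = M * (\<integral>y. bump r (x - y) \<partial>lebesgue_on \<Omega>)" by simp
  also have "\<dots> \<le> M * bump_mass r"
    using integral_bump_domain_le[OF r] M(2) by (rule mult_left_mono)
  finally show ?thesis .
qed

text \<open>With the ball inside \<Omega> the kernel keeps its full mass, so \<open>f x\<close> can
  be moved under the integral and only the oscillation of \<open>f\<close> on the ball
  remains.\<close>

lemma norm_mollify_diff_le:
  fixes f :: "real^3 \<Rightarrow> 'a::euclidean_space"
  assumes f: "f \<in> L2 \<Omega>" and r: "0 < r" and x: "ball x r \<subseteq> \<Omega>"
    and e: "AE y in lebesgue_on \<Omega>. dist x y < r \<longrightarrow> norm (f y - f x) \<le> e"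
  shows "norm (mollify \<Omega> r f x - bump_mass r *\<^sub>R f x) \<le> e * bump_mass r"
proof -
  let ?L = "lebesgue_on \<Omega>"
  note int = integrable_bump_scaleR[OF f, of r x] integrable_scaleR_left[OF bump_domain_integrable[OF r], of x "f x"]
  have diff: "bump r (x - y) *\<^sub>R (f y - f x) = bump r (x - y) *\<^sub>R f y - bump r (x - y) *\<^sub>R f x" for y
    by (rule scaleR_diff_right)
  have "mollify \<Omega> r f x - bump_mass r *\<^sub>R f x = (\<integral>y. bump r (x - y) *\<^sub>R (f y - f x) \<partial>?L)"
    unfolding diff using int bump_domain_integrable[OF r]
    by (simp add: mollify_def integral_bump_domain_eq[OF r x])
  also have "norm \<dots> \<le> (\<integral>y. norm (bump r (x - y) *\<^sub>R (f y - f x)) \<partial>?L)"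
    by (rule integral_norm_bound)
  also have "\<dots> \<le> (\<integral>y. e * bump r (x - y) \<partial>?L)"
  proof (rule integral_mono_AE)
    show "integrable ?L (\<lambda>y. norm (bump r (x - y) *\<^sub>R (f y - f x)))"
      unfolding diff using int by (intro integrable_norm Bochner_Integration.integrable_diff)
    show "integrable ?L (\<lambda>y. e * bump r (x - y))"
      using bump_domain_integrable[OF r] by simp
    show "AE y in ?L. norm (bump r (x - y) *\<^sub>R (f y - f x)) \<le> e * bump r (x - y)"
      using e
    proof eventually_elim
      case (elim y)
      then show ?case
        using bump_eq_0[OF r, of "x - y"] bump_nonneg[of r "x - y"]
          mult_right_mono[of "norm (f y - f x)" e "bump r (x - y)"]
        by (cases "dist x y < r") (auto simp: dist_norm mult.commute)
    qed
  qed
  also have "\<dots> = e * bump_mass r" by (simp add: integral_bump_domain_eq[OF r x])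
  finally show ?thesis .
qed

text \<open>For a general square integrable \<open>f\<close> this is the \<open>L2\<close> convergence of mollifications; for
  regulated \<open>f\<close> pointwise convergence and dominated convergence suffice.\<close>
lemma mollify_tendsto:
  fixes f g :: "real^3 \<Rightarrow> 'a::euclidean_space"
  assumes f: "regulated \<Omega> f" and g: "g \<in> L2 \<Omega>"
    and r: "\<And>n. 0 < r n" "r \<longlonglongrightarrow> 0"
    and meas: "\<And>n. mollify \<Omega> (r n) f \<in> borel_measurable (lebesgue_on \<Omega>)"
  shows "(\<lambda>n. L2_inner \<Omega> g (\<lambda>x. inverse (bump_mass (r n)) *\<^sub>R mollify \<Omega> (r n) f x)) \<longlonglongrightarrow> L2_inner \<Omega> g f"
proof -
  let ?L = "lebesgue_on \<Omega>"
  define m where "m n x = inverse (bump_mass (r n)) *\<^sub>R mollify \<Omega> (r n) f x" for n x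
  have fL2: "f \<in> L2 \<Omega>" using f by (simp add: regulated_def)
  obtain M0 where M0: "AE x in ?L. norm (f x) \<le> M0" using f by (auto simp: regulated_def)
  define M where "M = max 0 M0"
  have M: "AE x in ?L. norm (f x) \<le> M" "0 \<le> M"
    using M0 by (auto simp: M_def elim: eventually_mono)
  have mass: "0 < bump_mass (r n)" for n by (rule bump_mass_pos[OF r(1)])
  have bound: "norm (m n x) \<le> M" for n x
    using norm_mollify_le[OF fL2 r(1) M, of n x] mass[of n]
    by (simp add: m_def field_simps)
  have lim: "AE x in ?L. (\<lambda>n. m n x) \<longlonglongrightarrow> f x"
  proof -
    have "AE x in ?L. \<forall>e>0. \<exists>d>0. AE y in ?L. dist x y < d \<longrightarrow> norm (f y - f x) \<le> e"
      using f by (simp add: regulated_def)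
    then show ?thesis
    proof (rule AE_mp, intro AE_I2 impI)
      fix x assume "x \<in> space ?L" and x: "\<forall>e>0. \<exists>d>0. AE y in ?L. dist x y < d \<longrightarrow> norm (f y - f x) \<le> e"
      \<comment> \<open>For a fixed point of the open domain all small kernels lie inside \<Omega>;
        the loss of mass near the boundary therefore does not affect the pointwise limit.\<close>
      then obtain d0 where d0: "0 < d0" "ball x d0 \<subseteq> \<Omega>"
        using open_domain open_contains_ball[of \<Omega>] by auto
      show "(\<lambda>n. m n x) \<longlonglongrightarrow> f x"
      proof (rule metric_LIMSEQ_I)
        fix e :: real assume e: "0 < e"
        then obtain d where d: "0 < d" "AE y in ?L. dist x y < d \<longrightarrow> norm (f y - f x) \<le> e / 2"
          using x half_gt_zero by blast
        obtain N where N: "\<And>n. n \<ge> N \<Longrightarrow> r n < min d d0"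
          using order_tendstoD(2)[OF r(2), of "min d d0"] d(1) d0(1)
          by (auto simp: eventually_sequentially)
        have "dist (m n x) (f x) < e" if "n \<ge> N" for n
        proof -
          have "norm (mollify \<Omega> (r n) f x - bump_mass (r n) *\<^sub>R f x) \<le> e / 2 * bump_mass (r n)"
          proof (rule norm_mollify_diff_le[OF fL2 r(1)])
            show "ball x (r n) \<subseteq> \<Omega>" using d0(2) N[OF that] by (auto simp: subset_iff)
            show "AE y in ?L. dist x y < r n \<longrightarrow> norm (f y - f x) \<le> e / 2"
              using d(2) by eventually_elim (use N[OF that] in auto)
          qed
          moreover have "m n x - f x
              = inverse (bump_mass (r n)) *\<^sub>R (mollify \<Omega> (r n) f x - bump_mass (r n) *\<^sub>R f x)"
            using mass[of n] by (simp add: m_def scaleR_diff_right)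
          ultimately have "norm (m n x - f x) \<le> inverse (bump_mass (r n)) * (e / 2 * bump_mass (r n))"
            using mass[of n] by (simp add: mult_left_mono del: times_divide_eq_left)
          then have "norm (m n x - f x) \<le> e / 2"
            using mass[of n] by (simp add: field_simps)
          then show ?thesis using e by (simp add: dist_norm)
        qed
        then show "\<exists>N. \<forall>n\<ge>N. dist (m n x) (f x) < e" by blast
      qed
    qed
  qed
  \<comment> \<open>The normalised mollifications are bounded by \<open>M\<close>, and
    \<open>g\<close> is integrable because \<Omega> has finite measure.\<close>
  have "(\<lambda>n. \<integral>x. g x \<bullet> m n x \<partial>?L) \<longlonglongrightarrow> (\<integral>x. g x \<bullet> f x \<partial>?L)"
  proof (rule integral_dominated_convergence[where w="\<lambda>x. norm (g x) * M"])
    show "(\<lambda>x. g x \<bullet> f x) \<in> borel_measurable ?L"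
      by (intro borel_measurable_inner L2_measurable g fL2)
    show "(\<lambda>x. g x \<bullet> m n x) \<in> borel_measurable ?L" for n
      unfolding m_def
      by (rule borel_measurable_inner[OF L2_measurable[OF g] borel_measurable_scaleR[OF borel_measurable_const meas]])
    show "integrable ?L (\<lambda>x. norm (g x) * M)"
      using L2_imp_integrable[OF g] by simp
    show "AE x in ?L. (\<lambda>n. g x \<bullet> m n x) \<longlonglongrightarrow> g x \<bullet> f x"
      using lim by eventually_elim (intro tendsto_intros)
    show "AE x in ?L. norm (g x \<bullet> m n x) \<le> norm (g x) * M" for n
    proof (intro AE_I2)
      fix x
      have "\<bar>g x \<bullet> m n x\<bar> \<le> norm (g x) * norm (m n x)" by (rule Cauchy_Schwarz_ineq2)
      also have "\<dots> \<le> norm (g x) * M" by (intro mult_left_mono bound) simp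
      finally show "norm (g x \<bullet> m n x) \<le> norm (g x) * M" by simp
    qed
  qed
  then show ?thesis by (simp add: L2_inner_def m_def)
qed

text \<open>The two zero traces enter differently: that of \<open>b\<close> through
  \<open>curl_mollify\<close>, that of \<open>a\<close> by testing it with the mollified
  \<open>b\<close>. Only \<open>b\<close> and its curl pass to a limit, hence the asymmetric
  regularity assumptions.\<close>

lemma curl_symmetric:
  assumes a: "zero_tangential_trace \<Omega> a" "has_weak_curl \<Omega> a a'"
    and b: "zero_tangential_trace \<Omega> b" "has_weak_curl \<Omega> b b'"
    and reg: "regulated \<Omega> b" "regulated \<Omega> b'"
  shows "L2_inner \<Omega> a' b = L2_inner \<Omega> a b'"
proof -
  define r where "r n = inverse (real (Suc n))" for n
  have r: "0 < r n" for n by (simp add: r_def)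
  have r0: "r \<longlonglongrightarrow> 0" unfolding r_def by (rule LIMSEQ_inverse_real_of_nat)
  note aL2 = has_weak_curl_L2[OF a(2)] and bL2 = has_weak_curl_L2[OF b(2)]
  have Ck: "Ck (Suc 0) (\<lambda>x. mollify \<Omega> (r n) b x $ i)" "Ck (Suc 0) (\<lambda>x. mollify \<Omega> (r n) b' x $ i)" for n i
    by (rule mollify_field_Ck[OF bL2(1) r] mollify_field_Ck[OF bL2(2) r])+
  have meas: "mollify \<Omega> (r n) b \<in> borel_measurable (lebesgue_on \<Omega>)"
    "mollify \<Omega> (r n) b' \<in> borel_measurable (lebesgue_on \<Omega>)" for n
    by (intro continuous_measurable continuous_on_field Ck)+
  have "L2_inner \<Omega> a' (mollify \<Omega> (r n) b) = L2_inner \<Omega> a (mollify \<Omega> (r n) b')" for n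
  proof -
    have "has_weak_curl \<Omega> (mollify \<Omega> (r n) b) (mollify \<Omega> (r n) b')"
      using has_weak_curl_classical[OF Ck(1), of n] curl_mollify[OF b r, of n]
      by (metis (no_types, lifting) ext)
    then show ?thesis
      using a H1_field_classical[OF Ck(1), of n] unfolding zero_tangential_trace_def
      by (metis eq_iff_diff_eq_0)
  qed
  then have "L2_inner \<Omega> a' (\<lambda>x. inverse (bump_mass (r n)) *\<^sub>R mollify \<Omega> (r n) b x)
      = L2_inner \<Omega> a (\<lambda>x. inverse (bump_mass (r n)) *\<^sub>R mollify \<Omega> (r n) b' x)" for n
    by (simp add: L2_inner_scaleR_right)
  then show ?thesis
    using mollify_tendsto[OF reg(1) aL2(2) r r0 meas(1)] mollify_tendsto[OF reg(2) aL2(1) r r0 meas(2)]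
    by (simp add: LIMSEQ_unique)
qed

text \<open>Cells are convex, so their frontiers are null sets and almost every point of \<Omega> is
  interior to a cell. There the field agrees almost everywhere with a continuous shape function,
  which is bounded since the cell is compact.\<close>

lemma finite_element_regulated:
  fixes f :: "real^3 \<Rightarrow> 'a::euclidean_space"
  assumes mesh: "mesh \<Omega> \<T>" and V: "finite_element_space \<Omega> \<T> V" and f: "f \<in> V"
  shows "regulated \<Omega> f"
proof -
  have fin: "finite \<T>" and poly: "\<And>K. K \<in> \<T> \<Longrightarrow> polytope K" and cover: "\<Omega> \<subseteq> \<Union>\<T>"
    using mesh closure_subset[of \<Omega>] by (auto simp: mesh_def)
  have "\<forall>K\<in>\<T>. \<exists>s. continuous_on K s \<and> (AE x in lebesgue_on (interior K). f x = s x)"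
    using V f by (simp add: finite_element_space_def)
  then obtain s where s: "\<And>K. K \<in> \<T> \<Longrightarrow> continuous_on K (s K)"
    and fs: "\<And>K. K \<in> \<T> \<Longrightarrow> AE x in lebesgue_on (interior K). f x = s K x"
    by metis
  have fs': "AE x in lebesgue. x \<in> interior K \<longrightarrow> f x = s K x" if "K \<in> \<T>" for K
    using fs[OF that] by (subst (asm) AE_restrict_space_iff) auto
  have fr: "AE x in lebesgue. x \<notin> frontier K" if "K \<in> \<T>" for K
    using negligible_convex_frontier[OF polytope_imp_convex[OF poly[OF that]]]
    by (simp add: negligible_iff_null_sets AE_not_in)
  have good: "AE x in lebesgue_on \<Omega>. \<exists>K\<in>\<T>. x \<in> interior K \<and> f x = s K x"
  proof -
    have "AE x in lebesgue. \<forall>K\<in>\<T>. (x \<in> interior K \<longrightarrow> f x = s K x) \<and> x \<notin> frontier K"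
      using fs' fr by (intro AE_finite_allI[OF fin]) auto
    then have "AE x in lebesgue. x \<in> \<Omega> \<longrightarrow> (\<exists>K\<in>\<T>. x \<in> interior K \<and> f x = s K x)"
    proof eventually_elim
      case (elim x)
      show ?case
      proof
        assume "x \<in> \<Omega>"
        then obtain K where "K \<in> \<T>" "x \<in> K" using cover by auto
        then show "\<exists>K\<in>\<T>. x \<in> interior K \<and> f x = s K x"
          using elim closure_subset[of K] by (auto simp: frontier_def)
      qed
    qed
    then show ?thesis by (subst AE_restrict_space_iff) auto
  qed
  have "\<forall>K\<in>\<T>. \<exists>M. \<forall>x\<in>K. norm (s K x) \<le> M"
    using compact_continuous_image[OF s] polytope_imp_compact[OF poly] compact_imp_bounded
    by (metis bounded_iff imageI)
  then obtain M where M: "\<And>K x. K \<in> \<T> \<Longrightarrow> x \<in> K \<Longrightarrow> norm (s K x) \<le> M K" by metis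
  \<comment> \<open>The sum of absolute values is a common bound for the finitely many
    cells.\<close>
  have bdd: "AE x in lebesgue_on \<Omega>. norm (f x) \<le> (\<Sum>K\<in>\<T>. \<bar>M K\<bar>)"
    using good
  proof eventually_elim
    case (elim x)
    then obtain K where K: "K \<in> \<T>" "x \<in> interior K" "f x = s K x" by blast
    then have "norm (f x) \<le> \<bar>M K\<bar>" using M[OF K(1), of x] interior_subset[of K] by auto
    also have "\<dots> \<le> (\<Sum>K\<in>\<T>. \<bar>M K\<bar>)" using fin K(1) by (intro member_le_sum) auto
    finally show ?case .
  qed
  have "AE x in lebesgue_on \<Omega>. \<forall>e>0. \<exists>d>0. AE y in lebesgue_on \<Omega>. dist x y < d \<longrightarrow> norm (f y - f x) \<le> e"
    using good
  proof eventually_elim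
    case (elim x)
    then obtain K where K: "K \<in> \<T>" "x \<in> interior K" "f x = s K x" by blast
    show ?case
    proof (intro allI impI)
      fix e :: real assume "0 < e"
      have "isCont (s K) x"
        using s[OF K(1)] K(2) by (simp add: continuous_on_interior)
      then obtain d1 where d1: "0 < d1" "\<And>y. dist y x < d1 \<Longrightarrow> dist (s K y) (s K x) < e"
        using \<open>0 < e\<close> unfolding continuous_at_eps_delta by blast
      obtain d2 where d2: "0 < d2" "ball x d2 \<subseteq> interior K"
        using K(2) open_contains_ball[of "interior K"] by auto
      have "AE y in lebesgue_on \<Omega>. y \<in> interior K \<longrightarrow> f y = s K y"
        using fs'[OF K(1)] by (subst AE_restrict_space_iff) (auto elim: eventually_mono)
      then have "AE y in lebesgue_on \<Omega>. dist x y < min d1 d2 \<longrightarrow> norm (f y - f x) \<le> e"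
      proof eventually_elim
        case (elim y)
        show ?case
        proof
          assume "dist x y < min d1 d2"
          then have "y \<in> interior K" "dist (s K y) (s K x) < e"
            using d1(2)[of y] d2(2) by (auto simp: dist_commute)
          then show "norm (f y - f x) \<le> e"
            using elim K(3) by (simp add: dist_norm)
        qed
      qed
      then show "\<exists>d>0. AE y in lebesgue_on \<Omega>. dist x y < d \<longrightarrow> norm (f y - f x) \<le> e"
        using d1(1) d2(1) by (intro exI[of _ "min d1 d2"]) auto
    qed
  qed
  moreover have "f \<in> L2 \<Omega>" using V f by (auto simp: finite_element_space_def)
  ultimately show ?thesis
    using bdd unfolding regulated_def by blast
qed

end

subsection \<open>The scheme\<close>

lemma has_weak_curl_weak_curl: "v \<in> H_curl \<Omega> \<Longrightarrow> has_weak_curl \<Omega> v (weak_curl \<Omega> v)"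
  unfolding weak_curl_def H_curl_def by (blast intro: someI[of "has_weak_curl \<Omega> v"])

lemma has_weak_div_weak_div: "v \<in> H_div \<Omega> \<Longrightarrow> has_weak_div \<Omega> v (weak_div \<Omega> v)"
  unfolding weak_div_def H_div_def by (blast intro: someI[of "has_weak_div \<Omega> v"])

lemma finite_element_spaceD:
  assumes "finite_element_space \<Omega> \<T> V"
  shows "V \<subseteq> L2 \<Omega>"
    and "f \<in> V \<Longrightarrow> g \<in> V \<Longrightarrow> (\<lambda>x. f x + g x) \<in> V"
    and "f \<in> V \<Longrightarrow> (\<lambda>x. c *\<^sub>R f x) \<in> V"
  using assms by (simp_all add: finite_element_space_def)

text \<open>The divergence theorem: the constant 1 is an \<open>H1\<close> function with zero
  gradient, and the normal trace vanishes on it. The divergence thereby becomes an admissible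
  pressure test function.\<close>

lemma (in bounded_domain) div_mean_zero:
  assumes "zero_normal_trace \<Omega> v" "has_weak_div \<Omega> v d"
  shows "d \<in> L2_mean_zero \<Omega>"
proof -
  have der: "((\<lambda>x. 1::real) has_derivative (\<lambda>h. 0 \<bullet> h)) (at x)" for x :: "real^3" by simp
  have "grad (\<lambda>x. 1) = (\<lambda>x. 0)"
    using partial_eqI[OF der] by (simp add: grad_def fun_eq_iff vec_eq_iff)
  then have "has_weak_grad \<Omega> (\<lambda>x. 1) (\<lambda>x. 0)"
    using has_weak_grad_classical[OF Ck_1I[OF der]] by simp
  then have "L2_inner \<Omega> d (\<lambda>x. 1) + L2_inner \<Omega> v (\<lambda>x. 0) = 0"
    using assms unfolding zero_normal_trace_def by blast
  then show ?thesis
    using has_weak_div_L2(2)[OF assms(2)] unfolding L2_mean_zero_def by (simp add: L2_inner_def)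
qed

section \<open>Consequences of the discrete complex\<close>

locale de_Rham = bounded_domain +
  fixes \<T> Vg Vc Vd Vl
  assumes de_Rham: "de_Rham_sequence \<Omega> \<T> Vg Vc Vd Vl"
begin

lemma fe_Vc: "finite_element_space \<Omega> \<T> Vc" and fe_Vd: "finite_element_space \<Omega> \<T> Vd"
  and Vc_sub: "Vc \<subseteq> H_curl_0 \<Omega>" and Vd_sub: "Vd \<subseteq> H_div_0 \<Omega>" and mesh: "mesh \<Omega> \<T>"
  and exact: "{w. \<exists>v \<in> Vc. has_weak_curl \<Omega> v w} = {w \<in> Vd. has_weak_div \<Omega> w (\<lambda>x. 0)}"
  using de_Rham by (simp_all add: de_Rham_sequence_def)

lemma Vc_L2: "v \<in> Vc \<Longrightarrow> v \<in> L2 \<Omega>" and Vd_L2: "v \<in> Vd \<Longrightarrow> v \<in> L2 \<Omega>"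
  using finite_element_spaceD(1)[OF fe_Vc] finite_element_spaceD(1)[OF fe_Vd] by auto

lemma Vc_weak_curl: "v \<in> Vc \<Longrightarrow> has_weak_curl \<Omega> v (weak_curl \<Omega> v)"
  using Vc_sub by (auto simp: H_curl_0_def intro: has_weak_curl_weak_curl)

lemma Vd_weak_div: "v \<in> Vd \<Longrightarrow> has_weak_div \<Omega> v (weak_div \<Omega> v)"
  using Vd_sub by (auto simp: H_div_0_def intro: has_weak_div_weak_div)

lemma weak_curl_Vd: "v \<in> Vc \<Longrightarrow> has_weak_curl \<Omega> v w \<Longrightarrow> w \<in> Vd \<and> has_weak_div \<Omega> w (\<lambda>x. 0)"
  using exact by blast

text \<open>The complex places the curl of \<open>b\<close> in \<open>Vd\<close>, so this curl is
  again a finite element field and therefore regulated.\<close>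

lemma Vc_green:
  assumes "a \<in> Vc" "has_weak_curl \<Omega> a a'" "b \<in> Vc" "has_weak_curl \<Omega> b b'"
  shows "L2_inner \<Omega> a' b = L2_inner \<Omega> a b'"
proof (rule curl_symmetric)
  show "zero_tangential_trace \<Omega> a" "zero_tangential_trace \<Omega> b"
    using assms Vc_sub by (auto simp: H_curl_0_def)
  show "regulated \<Omega> b" by (rule finite_element_regulated[OF mesh fe_Vc assms(3)])
  show "regulated \<Omega> b'"
    using weak_curl_Vd[OF assms(3,4)] finite_element_regulated[OF mesh fe_Vd] by blast
qed fact+

end

text \<open>The discrete form of the time derivative of half the squared norm. The midpoint average
  makes the product a difference of squares, without a dissipative remainder.\<close>

lemma inner_time_average_difference_quotient:
  assumes "v0 \<in> L2 \<Omega>" "v1 \<in> L2 \<Omega>"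
  shows "L2_inner \<Omega> (difference_quotient dt v0 v1) (time_average v0 v1)
    = (L2_inner \<Omega> v1 v1 - L2_inner \<Omega> v0 v0) / (2 * dt)"
proof -
  have "L2_inner \<Omega> (difference_quotient dt v0 v1) (time_average v0 v1)
    = (1/dt) * ((1/2) * L2_inner \<Omega> (\<lambda>x. v1 x - v0 x) (\<lambda>x. v1 x + v0 x))"
    unfolding difference_quotient_def[abs_def] time_average_def[abs_def]
      L2_inner_scaleR_left L2_inner_scaleR_right ..
  also have "L2_inner \<Omega> (\<lambda>x. v1 x - v0 x) (\<lambda>x. v1 x + v0 x) = L2_inner \<Omega> v1 v1 - L2_inner \<Omega> v0 v0"
    using assms by (simp add: L2_inner_diff_left L2_inner_add_right L2_add L2_inner_commute[of \<Omega> v0 v1])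
  finally show ?thesis by simp
qed

section \<open>Constraints and conservation laws for a single time step\<close>

locale mhd_step = de_Rham +
  fixes S R\<^sub>H dt u0 B0 u1 B1 p E j H \<omega> U \<alpha>
  assumes step: "scheme_step \<Omega> Vc Vd S R\<^sub>H dt u0 B0 u1 B1 p E j H \<omega> U \<alpha>"
    and dt: "dt > 0"
    and u0: "u0 \<in> Vd" "has_weak_div \<Omega> u0 (\<lambda>x. 0)"
    and B0: "B0 \<in> Vd" "has_weak_div \<Omega> B0 (\<lambda>x. 0)"
begin

lemma step_mem: "u1 \<in> Vd" "B1 \<in> Vd" "p \<in> L2_mean_zero \<Omega>" "E \<in> Vc" "j \<in> Vc" "H \<in> Vc"
  "\<omega> \<in> Vc" "U \<in> Vc" "\<alpha> \<in> Vc"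
  using step by (simp_all add: scheme_step_def)

lemma momentum: "v \<in> Vd \<Longrightarrow> L2_inner \<Omega> (difference_quotient dt u0 u1) v + L2_inner \<Omega> \<alpha> v
    + L2_inner \<Omega> (weak_div \<Omega> v) p = 0"
  and incompressibility: "q \<in> L2_mean_zero \<Omega> \<Longrightarrow> L2_inner \<Omega> (weak_div \<Omega> (time_average u0 u1)) q = 0"
  and faraday: "C \<in> Vd \<Longrightarrow> L2_inner \<Omega> (difference_quotient dt B0 B1) C + L2_inner \<Omega> (weak_curl \<Omega> E) C = 0"
  and ampere: "F \<in> Vc \<Longrightarrow> L2_inner \<Omega> j F = L2_inner \<Omega> (time_average B0 B1) (weak_curl \<Omega> F)"
  and magnetic: "F \<in> Vc \<Longrightarrow> L2_inner \<Omega> H F = L2_inner \<Omega> (time_average B0 B1) F"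
  and velocity: "F \<in> Vc \<Longrightarrow> L2_inner \<Omega> U F = L2_inner \<Omega> (time_average u0 u1) F"
  and force: "F \<in> Vc \<Longrightarrow> L2_inner \<Omega> \<alpha> F = L2_inner \<Omega> (\<lambda>x. cross3 (\<omega> x) (U x)) F
               - S * L2_inner \<Omega> (\<lambda>x. cross3 (j x) (H x)) F"
  and ohm: "F \<in> Vc \<Longrightarrow> L2_inner \<Omega> E F = L2_inner \<Omega> (\<lambda>x. cross3 (R\<^sub>H *\<^sub>R j x - U x) (H x)) F"
  using step by (simp_all add: scheme_step_def algebra_simps)

lemma time_average_Vd: "v0 \<in> Vd \<Longrightarrow> v1 \<in> Vd \<Longrightarrow> time_average v0 v1 \<in> Vd"
  unfolding time_average_def[abs_def] by (intro finite_element_spaceD[OF fe_Vd])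

lemma difference_quotient_Vd:
  assumes "v0 \<in> Vd" "v1 \<in> Vd" shows "difference_quotient dt v0 v1 \<in> Vd"
proof -
  have "(\<lambda>x. (1/dt) *\<^sub>R (v1 x + (-1) *\<^sub>R v0 x)) \<in> Vd"
    by (intro finite_element_spaceD[OF fe_Vd] assms)
  then show ?thesis by (simp add: difference_quotient_def[abs_def])
qed

text \<open>The divergence has mean zero and so can be tested against itself. The first form
  concerns the representative in the pressure term; the second combines linearly with other
  fields.\<close>

lemma div_average_0: "AE x in lebesgue_on \<Omega>. weak_div \<Omega> (time_average u0 u1) x = 0"
  and average_div_free: "has_weak_div \<Omega> (time_average u0 u1) (\<lambda>x. 0)"
proof -
  let ?v = "time_average u0 u1"
  have v: "?v \<in> Vd" by (rule time_average_Vd[OF u0(1) step_mem(1)])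
  note d = Vd_weak_div[OF v]
  have "weak_div \<Omega> ?v \<in> L2_mean_zero \<Omega>"
    using v Vd_sub by (intro div_mean_zero[OF _ d]) (auto simp: H_div_0_def)
  then show ae: "AE x in lebesgue_on \<Omega>. weak_div \<Omega> ?v x = 0"
    by (intro L2_inner_self_eq_0 incompressibility has_weak_div_L2[OF d])
  show "has_weak_div \<Omega> ?v (\<lambda>x. 0)"
    by (rule has_weak_div_cong_AE[OF d]) (use Vd_L2[OF v] ae in auto)
qed

lemma u1_div_free: "has_weak_div \<Omega> u1 (\<lambda>x. 0)"
proof -
  \<comment> \<open>The scheme constrains only the average, so \<open>u1\<close> is recovered as
    twice the average minus \<open>u0\<close>.\<close>
  have "has_weak_div \<Omega> (\<lambda>x. 2 *\<^sub>R time_average u0 u1 x + (-1) *\<^sub>R u0 x) (\<lambda>x. 2 *\<^sub>R 0 + (-1) *\<^sub>R 0)"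
    by (intro has_weak_div_add has_weak_div_scaleR average_div_free u0)
  then show ?thesis by (simp add: time_average_def scaleR_2)
qed

text \<open>The residual of Faraday's law lies in \<open>Vd\<close> because curls of
  \<open>Vc\<close> do. Tested with itself, it vanishes almost everywhere.\<close>

lemma B1_eq: "AE x in lebesgue_on \<Omega>. B1 x = B0 x - dt *\<^sub>R weak_curl \<Omega> E x"
proof -
  let ?D = "difference_quotient dt B0 B1" and ?c = "weak_curl \<Omega> E"
  have D: "?D \<in> Vd" by (rule difference_quotient_Vd[OF B0(1) step_mem(2)])
  have c: "?c \<in> Vd" using weak_curl_Vd[OF step_mem(4) Vc_weak_curl[OF step_mem(4)]] by blast
  have Dc: "(\<lambda>x. ?D x + ?c x) \<in> Vd" by (intro finite_element_spaceD[OF fe_Vd] D c)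
  have "L2_inner \<Omega> (\<lambda>x. ?D x + ?c x) (\<lambda>x. ?D x + ?c x) = 0"
    using faraday[OF Dc] by (simp add: L2_inner_add_left Vd_L2 D c Dc)
  then have "AE x in lebesgue_on \<Omega>. ?D x + ?c x = 0"
    by (rule L2_inner_self_eq_0[OF Vd_L2[OF Dc]])
  then show ?thesis
  proof eventually_elim
    case (elim x)
    then have "dt *\<^sub>R (?D x + ?c x) = 0" by simp
    then show ?case using dt by (simp add: difference_quotient_def scaleR_add_right algebra_simps)
  qed
qed

text \<open>The increment of the magnetic field is a curl of a \<open>Vc\<close> field, hence
  divergence free by the complex.\<close>

lemma B1_div_free: "has_weak_div \<Omega> B1 (\<lambda>x. 0)"
proof -
  have "has_weak_div \<Omega> (\<lambda>x. B0 x + (- dt) *\<^sub>R weak_curl \<Omega> E x) (\<lambda>x. 0 + (- dt) *\<^sub>R 0)"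
    using weak_curl_Vd[OF step_mem(4) Vc_weak_curl[OF step_mem(4)]]
    by (intro has_weak_div_add has_weak_div_scaleR B0) simp
  then show ?thesis
    by (rule has_weak_div_cong_AE) (use B1_eq Vd_L2[OF step_mem(2)] in \<open>auto elim: eventually_mono\<close>)
qed

text \<open>Testing the momentum equation with the midpoint velocity and Faraday's law with the
  midpoint magnetic field leaves the opposite work terms \<open>(j \<times> H, U)\<close> of the Lorentz force
  and of the electric field, because \<open>\<omega> \<times> U\<close> is orthogonal to \<open>U\<close> and the Hall term to \<open>j\<close>.\<close>
lemma energy:
  "L2_inner \<Omega> u1 u1 + S * L2_inner \<Omega> B1 B1 = L2_inner \<Omega> u0 u0 + S * L2_inner \<Omega> B0 B0"
proof -
  let ?u = "time_average u0 u1" and ?B = "time_average B0 B1"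
  define W where "W = L2_inner \<Omega> (\<lambda>x. cross3 (j x) (H x)) U"
  have u: "?u \<in> Vd" and B: "?B \<in> Vd"
    by (intro time_average_Vd u0 B0 step_mem)+
  \<comment> \<open>The pressure does no work, since the chosen divergence of the midpoint velocity
    is zero almost everywhere.\<close>
  have "L2_inner \<Omega> (weak_div \<Omega> ?u) p = L2_inner \<Omega> (\<lambda>x. 0) p"
    using step_mem(3) by (intro L2_inner_cong_AE div_average_0 has_weak_div_L2(2)[OF Vd_weak_div[OF u]])
      (auto simp: L2_mean_zero_def)
  moreover have "L2_inner \<Omega> \<alpha> ?u = - S * W"
  proof -
    \<comment> \<open>As \<alpha> lies in \<open>Vc\<close>, the midpoint velocity may be replaced
      by its projection \<open>U\<close>, which the force equation accepts as a test field.\<close>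
    have "L2_inner \<Omega> \<alpha> ?u = L2_inner \<Omega> \<alpha> U"
      using velocity[OF step_mem(9)] by (metis L2_inner_commute)
    moreover have "L2_inner \<Omega> (\<lambda>x. cross3 (\<omega> x) (U x)) U = 0"
      by (simp add: L2_inner_def dot_cross_self)
    ultimately show ?thesis using force[OF step_mem(8)] by (simp add: W_def)
  qed
  ultimately have "L2_inner \<Omega> (difference_quotient dt u0 u1) ?u = S * W"
    using momentum[OF u] by simp
  moreover have "L2_inner \<Omega> (difference_quotient dt B0 B1) ?B = - W"
  proof -
    \<comment> \<open>Ampere's law with test field \<open>E\<close> moves the curl from
      \<open>E\<close> to the current, and \<open>j\<close> is then a test field for Ohm's
      law.\<close>
    have "L2_inner \<Omega> (weak_curl \<Omega> E) ?B = L2_inner \<Omega> E j"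
      using ampere[OF step_mem(4)] by (simp add: L2_inner_commute)
    also have "\<dots> = W"
    proof -
      have "cross3 (R\<^sub>H *\<^sub>R a - c) b \<bullet> a = cross3 a b \<bullet> c" for a b c
        by (simp add: cross3_simps)
      then show ?thesis
        unfolding ohm[OF step_mem(5)] unfolding W_def L2_inner_def by simp
    qed
    finally show ?thesis using faraday[OF B] by simp
  qed
  ultimately have "(L2_inner \<Omega> u1 u1 - L2_inner \<Omega> u0 u0) / (2 * dt)
      + S * ((L2_inner \<Omega> B1 B1 - L2_inner \<Omega> B0 B0) / (2 * dt)) = 0"
    by (simp add: inner_time_average_difference_quotient Vd_L2 u0 B0 step_mem)
  then have "((L2_inner \<Omega> u1 u1 - L2_inner \<Omega> u0 u0) + S * (L2_inner \<Omega> B1 B1 - L2_inner \<Omega> B0 B0)) / (2 * dt) = 0"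
    by (simp add: add_divide_distrib)
  then show ?thesis using dt by (simp add: algebra_simps)
qed

text \<open>Up to a curl free field, \<open>A1 - A0\<close> is \<open>- dt\<close> times \<open>E\<close>, and \<open>E\<close> is orthogonal to
  the midpoint magnetic field because it is, after projection, a cross product with \<open>H\<close>.\<close>
lemma helicity:
  assumes A0: "A0 \<in> Vc" "has_weak_curl \<Omega> A0 B0" and A1: "A1 \<in> Vc" "has_weak_curl \<Omega> A1 B1"
  shows "L2_inner \<Omega> A1 B1 = L2_inner \<Omega> A0 B0"
proof -
  let ?G = "\<lambda>x. A1 x + ((-1) *\<^sub>R A0 x + dt *\<^sub>R E x)"
  let ?A = "\<lambda>x. A1 x + A0 x" and ?B = "\<lambda>x. B1 x + B0 x"
  note L2 = Vc_L2[OF A0(1)] Vc_L2[OF A1(1)] Vd_L2[OF B0(1)] Vd_L2[OF step_mem(2)] Vc_L2[OF step_mem(4)]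
  have G: "?G \<in> Vc" by (intro finite_element_spaceD[OF fe_Vc] A0 A1 step_mem)
  have "has_weak_curl \<Omega> ?G (\<lambda>x. B1 x + ((-1) *\<^sub>R B0 x + dt *\<^sub>R weak_curl \<Omega> E x))"
    by (intro has_weak_curl_add has_weak_curl_scaleR A0 A1 Vc_weak_curl step_mem)
  then have "has_weak_curl \<Omega> ?G (\<lambda>x. 0)"
    by (rule has_weak_curl_cong_AE)
      (use B1_eq Vc_L2[OF G] in \<open>auto elim: eventually_mono\<close>)
  moreover have "?A \<in> Vc" "has_weak_curl \<Omega> ?A ?B"
    by (intro finite_element_spaceD[OF fe_Vc] has_weak_curl_add A0 A1)+
  \<comment> \<open>Since \<open>?B\<close> is the curl of \<open>?A\<close>, Green's formula moves
    that curl onto \<open>?G\<close>, where it vanishes.\<close>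
  ultimately have "L2_inner \<Omega> ?G ?B = 0"
    using Vc_green[OF G] by fastforce
  moreover have "L2_inner \<Omega> E ?B = 0"
  proof -
    \<comment> \<open>\<open>H\<close> is the projection of the midpoint magnetic field to
      \<open>Vc\<close>. Replacing that field by \<open>H\<close> gives exact orthogonality, since
      Ohm's law tested with \<open>H\<close> contains a cross product with \<open>H\<close>.\<close>
    have "L2_inner \<Omega> E ?B = 2 * L2_inner \<Omega> (time_average B0 B1) E"
      by (simp add: time_average_def[abs_def] L2_inner_scaleR_left L2_inner_commute[of \<Omega> E])
    also have "\<dots> = 2 * L2_inner \<Omega> E H"
      using magnetic[OF step_mem(4)] by (simp add: L2_inner_commute)
    also have "L2_inner \<Omega> E H = 0"
      unfolding ohm[OF step_mem(6)] by (simp add: L2_inner_def dot_cross_self)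
    finally show ?thesis by simp
  qed
  ultimately have "L2_inner \<Omega> A1 ?B - L2_inner \<Omega> A0 ?B = 0"
    using L2 by (simp add: L2_inner_add_left L2_inner_diff_left L2_inner_scaleR_left L2_add L2_scaleR L2_diff)
  \<comment> \<open>The mixed terms of the expanded product cancel by the symmetry of the curl on
    \<open>Vc\<close>.\<close>
  moreover have "L2_inner \<Omega> A1 B0 = L2_inner \<Omega> A0 B1"
    using Vc_green[OF A1 A0] by (simp add: L2_inner_commute)
  ultimately show ?thesis
    using L2 by (simp add: L2_inner_add_right)
qed

end

text \<open>A discrete potential is determined only up to curl free fields, so the helicity identity
  is claimed for every choice at both levels. The existence clause, which follows from exactness,
  keeps it from being vacuous.\<close>

theorem theorem13:
  fixes \<Omega> :: "(real^3) set" and \<T> :: "(real^3) set set"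
    and Vg Vl :: "scalar_field set" and Vc Vd :: "vector_field set"
    and S R\<^sub>H dt :: real
    and u B E j H \<omega> U \<alpha> :: "nat \<Rightarrow> vector_field" and p :: "nat \<Rightarrow> scalar_field"
  assumes "lipschitz_polyhedron \<Omega>" and "bounded \<Omega>" and "contractible \<Omega>"
    and "de_Rham_sequence \<Omega> \<T> Vg Vc Vd Vl"
    and "S > 0" and "R\<^sub>H \<ge> 0" and "dt > 0"
    and "u 0 \<in> Vd" and "B 0 \<in> Vd"
    and "has_weak_div \<Omega> (u 0) (\<lambda>x. 0)" and "has_weak_div \<Omega> (B 0) (\<lambda>x. 0)"
    and "\<And>k. scheme_step \<Omega> Vc Vd S R\<^sub>H dt (u k) (B k) (u (Suc k)) (B (Suc k))
                 (p k) (E k) (j k) (H k) (\<omega> k) (U k) (\<alpha> k)"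
  shows "\<forall>k.
     (\<integral>x. u (Suc k) x \<bullet> u (Suc k) x + S * (B (Suc k) x \<bullet> B (Suc k) x) \<partial>lebesgue_on \<Omega>)
       = (\<integral>x. u k x \<bullet> u k x + S * (B k x \<bullet> B k x) \<partial>lebesgue_on \<Omega>) \<and>
     (\<exists>A \<in> Vc. has_weak_curl \<Omega> A (B k)) \<and>
     (\<forall>A0 \<in> Vc. \<forall>A1 \<in> Vc. has_weak_curl \<Omega> A0 (B k) \<and> has_weak_curl \<Omega> A1 (B (Suc k)) \<longrightarrow>
        (\<integral>x. A1 x \<bullet> B (Suc k) x \<partial>lebesgue_on \<Omega>) = (\<integral>x. A0 x \<bullet> B k x \<partial>lebesgue_on \<Omega>)) \<and>
     has_weak_div \<Omega> (u k) (\<lambda>x. 0) \<and> has_weak_div \<Omega> (B k) (\<lambda>x. 0)"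
proof -
  interpret de_Rham \<Omega> \<T> Vg Vc Vd Vl
    using assms(1,2,4) by unfold_locales (auto simp: lipschitz_polyhedron_def)
  have step: "mhd_step \<Omega> \<T> Vg Vc Vd Vl S R\<^sub>H dt (u k) (B k) (u (Suc k)) (B (Suc k))
      (p k) (E k) (j k) (H k) (\<omega> k) (U k) (\<alpha> k)"
    if "u k \<in> Vd" "has_weak_div \<Omega> (u k) (\<lambda>x. 0)" "B k \<in> Vd" "has_weak_div \<Omega> (B k) (\<lambda>x. 0)" for k
    using that assms(7,12) by unfold_locales
  \<comment> \<open>One step controls the midpoint divergence of \<open>u\<close> and the increment
    of \<open>B\<close>; the constraints at level \<open>k\<close> are what turns this into
    constraints at level \<open>k + 1\<close>.\<close>
  have inv: "u k \<in> Vd \<and> has_weak_div \<Omega> (u k) (\<lambda>x. 0) \<and> B k \<in> Vd \<and> has_weak_div \<Omega> (B k) (\<lambda>x. 0)" for k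
  proof (induction k)
    case (Suc k)
    then interpret mhd_step \<Omega> \<T> Vg Vc Vd Vl S R\<^sub>H dt "u k" "B k" "u (Suc k)" "B (Suc k)"
        "p k" "E k" "j k" "H k" "\<omega> k" "U k" "\<alpha> k"
      by (intro step) auto
    show ?case using step_mem u1_div_free B1_div_free by blast
  qed (use assms in auto)
  have total: "(\<integral>x. u k x \<bullet> u k x + S * (B k x \<bullet> B k x) \<partial>lebesgue_on \<Omega>)
      = L2_inner \<Omega> (u k) (u k) + S * L2_inner \<Omega> (B k) (B k)" for k
    using inv[of k] by (simp add: L2_inner_def L2_integrable_inner Vd_L2)
  show ?thesis
  proof
    fix k
    interpret mhd_step \<Omega> \<T> Vg Vc Vd Vl S R\<^sub>H dt "u k" "B k" "u (Suc k)" "B (Suc k)"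
        "p k" "E k" "j k" "H k" "\<omega> k" "U k" "\<alpha> k"
      using inv by (intro step) auto
    have "\<exists>A \<in> Vc. has_weak_curl \<Omega> A (B k)"
      using exact B0 by blast
    then show "(\<integral>x. u (Suc k) x \<bullet> u (Suc k) x + S * (B (Suc k) x \<bullet> B (Suc k) x) \<partial>lebesgue_on \<Omega>)
       = (\<integral>x. u k x \<bullet> u k x + S * (B k x \<bullet> B k x) \<partial>lebesgue_on \<Omega>) \<and>
     (\<exists>A \<in> Vc. has_weak_curl \<Omega> A (B k)) \<and>
     (\<forall>A0 \<in> Vc. \<forall>A1 \<in> Vc. has_weak_curl \<Omega> A0 (B k) \<and> has_weak_curl \<Omega> A1 (B (Suc k)) \<longrightarrow>
        (\<integral>x. A1 x \<bullet> B (Suc k) x \<partial>lebesgue_on \<Omega>) = (\<integral>x. A0 x \<bullet> B k x \<partial>lebesgue_on \<Omega>)) \<and>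
     has_weak_div \<Omega> (u k) (\<lambda>x. 0) \<and> has_weak_div \<Omega> (B k) (\<lambda>x. 0)"
      using total[of k] total[of "Suc k"] energy helicity inv[of k]
      by (simp add: L2_inner_def)
  qed
qed

end
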